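(* Let $G=(V,E)$ be a finite simple cone graph with distinguished cone vertex $v_*$ (so $v_*$ is adjacent to every other vertex), viewed as a point-line graph with $V=V_p\cup V_l$, where $V_l=\{v_*\}$ (a single line) and $V_p=V\setminus\{v_*\}$. Suppose that the subgraph of $G$ induced by $V_p$ is connected and has at least $4$ vertices. Then the following statements are equivalent: (i) $G$ is a maximally independent point-line graph. (ii) There is a minimally infinitesimally rigid point-line framework realisation of $G$ in $\mathbb{R}^3$.
   Context: A point-line graph is a graph $G=(V,E)$ with a bipartition of its vertices $V=V_p\cup V_l$ (points and lines) and of its edges $E=E_{pp}\cup E_{pl}$, where $E_{pp}$ consists of the edges joining two points and $E_{pl}$ of the edges joining a point and a line; there are no edges joining two lines. For a subgraph $X$, $V_p(X)$, $V_l(X)$ and $E(X)$ denote its sets of point vertices, line vertices and edges. $G$ is a maximally independent point-line graph if $3|V_p|+4|V_l|-|E|=6$ and $3|V_p(X)|+4|V_l(X)|-|E(X)|\ge 6$ for every subgraph $X\subset G$ with at least one edge, other than a subgraph consisting of a single edge of $E_{pp}$ together with its two end vertices. For a cone graph with $n=|V_p|$ and one line vertex, a point-line (distance) framework realisation in $\mathbb{R}^3$ consists of points $p_1,\dots,p_n\in\mathbb{R}^3$ (for the vertices in $V_p$) and a straight line $p_*\subset\mathbb{R}^3$ (for $v_*$). The constraints are the squared distances $|p_i-p_j|^2$ for edges in $E_{pp}$ and the squared distances from $p_i$ to the line $p_*$ for edges in $E_{pl}$. These constraints define a smooth edge function on $(\mathbb{R}^3)^n\times\mathcal{L}$ where $\mathcal{L}$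 is the $4$-dimensional manifold of lines in $\mathbb{R}^3$. The realisation is infinitesimally rigid if every vector in the kernel of the derivative of the edge function at $(p_1,\dots,p_n,p_* )$ is induced by an infinitesimal isometry of $\mathbb{R}^3$; it is minimally infinitesimally rigid if moreover removing any edge of $G$ (i.e. dropping the corresponding constraint) destroys infinitesimal rigidity. *)

theory Defs
  imports "HOL-Analysis.Analysis"
begin

section \<open>Graphs\<close>

definition simple_graph :: "'v set \<Rightarrow> 'v set set \<Rightarrow> bool" where
  "simple_graph V E \<longleftrightarrow> finite V \<and> (\<forall>e\<in>E. e \<subseteq> V \<and> card e = 2)"

definition cone_graph :: "'v set \<Rightarrow> 'v set set \<Rightarrow> 'v \<Rightarrow> bool" where
  "cone_graph V E c \<longleftrightarrow> simple_graph V E \<and> c \<in> V \<and> (\<forall>w\<in>V - {c}. {c, w} \<in> E)"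

definition induced_edges :: "'v set set \<Rightarrow> 'v set \<Rightarrow> 'v set set" where
  "induced_edges E W = {e \<in> E. e \<subseteq> W}"

definition connected_graph :: "'v set \<Rightarrow> 'v set set \<Rightarrow> bool" where
  "connected_graph V E \<longleftrightarrow>
     V \<noteq> {} \<and> (\<forall>x\<in>V. \<forall>y\<in>V. (x, y) \<in> {(a, b). {a, b} \<in> E}\<^sup>*)"

definition point_line_graph :: "'v set \<Rightarrow> 'v set \<Rightarrow> 'v set set \<Rightarrow> bool" where
  "point_line_graph Vp Vl E \<longleftrightarrow>
     simple_graph (Vp \<union> Vl) E \<and> Vp \<inter> Vl = {} \<and> (\<forall>e\<in>E. \<not> e \<subseteq> Vl)"

definition point_line_subgraph ::
  "'v set \<Rightarrow> 'v set \<Rightarrow> 'v set set \<Rightarrow> 'v set \<Rightarrow> 'v set \<Rightarrow> 'v set set \<Rightarrow> bool" where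
  "point_line_subgraph Xp Xl F Vp Vl E \<longleftrightarrow>
     Xp \<subseteq> Vp \<and> Xl \<subseteq> Vl \<and> F \<subseteq> E \<and> (\<forall>e\<in>F. e \<subseteq> Xp \<union> Xl)"

definition freedom :: "'v set \<Rightarrow> 'v set \<Rightarrow> 'v set set \<Rightarrow> int" where
  "freedom Vp Vl E = 3 * int (card Vp) + 4 * int (card Vl) - int (card E)"

definition maximally_independent :: "'v set \<Rightarrow> 'v set \<Rightarrow> 'v set set \<Rightarrow> bool" where
  "maximally_independent Vp Vl E \<longleftrightarrow>
     point_line_graph Vp Vl E \<and> freedom Vp Vl E = 6 \<and>
     (\<forall>Xp Xl F. point_line_subgraph Xp Xl F Vp Vl E \<and> F \<noteq> {} \<and>
        \<not> (\<exists>e. F = {e} \<and> Xp = e \<and> Xl = {}) \<longrightarrow> freedom Xp Xl F \<ge> 6)"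

section \<open>Point-line frameworks in three-space with one line\<close>

definition line :: "real^3 \<Rightarrow> real^3 \<Rightarrow> (real^3) set" where
  "line q u = range (\<lambda>t. q + t *\<^sub>R u)"

definition lines :: "(real^3) set set" where
  "lines = {line q u |q u. u \<noteq> 0}"

text \<open>
  The manifold of lines is the quotient of the pairs \<open>(q, u)\<close> with \<open>u \<noteq> 0\<close> under the submersion
  \<open>(q, u) \<mapsto> line q u\<close>. By the next lemma the fibre through \<open>(q, u)\<close> consists of the pairs
  \<open>(q + s u, t u)\<close> with \<open>t \<noteq> 0\<close>, so tangent vectors of the manifold at \<open>line q u\<close> are represented
  by pairs \<open>(q', u')\<close> in which multiples of \<open>u\<close> may be added to either component, giving dimension
  \<open>6 - 2 = 4\<close>. A function of lines is differentiated by differentiating its composition with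
  \<open>(q, u) \<mapsto> line q u\<close>.
\<close>

lemma line_eq_iff:
  assumes "u \<noteq> 0" "w \<noteq> 0"
  shows "line q u = line r w \<longleftrightarrow> (\<exists>s t. t \<noteq> 0 \<and> r = q + s *\<^sub>R u \<and> w = t *\<^sub>R u)"
proof
  assume eq: "line q u = line r w"
  have "r + 0 *\<^sub>R w \<in> line r w" "r + 1 *\<^sub>R w \<in> line r w"
    unfolding line_def by blast+
  then obtain s s' where s: "r = q + s *\<^sub>R u" "r + w = q + s' *\<^sub>R u"
    unfolding eq[symmetric] unfolding line_def image_iff by (metis scaleR_one scaleR_zero_left add_0_right)
  then have "w = (s' - s) *\<^sub>R u"
    by (metis add_diff_cancel_left add_diff_cancel_left' scaleR_diff_left)
  with s \<open>w \<noteq> 0\<close> show "\<exists>s t. t \<noteq> 0 \<and> r = q + s *\<^sub>R u \<and> w = t *\<^sub>R u"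
    by (intro exI[of _ s] exI[of _ "s' - s"]) auto
next
  assume "\<exists>s t. t \<noteq> 0 \<and> r = q + s *\<^sub>R u \<and> w = t *\<^sub>R u"
  then obtain s t where st: "t \<noteq> 0" "r = q + s *\<^sub>R u" "w = t *\<^sub>R u" by blast
  have "q + x *\<^sub>R u = r + ((x - s) / t) *\<^sub>R w" for x
    using st by (simp add: scaleR_diff_left)
  moreover have "r + x *\<^sub>R w = q + (s + x * t) *\<^sub>R u" for x
    using st by (simp add: scaleR_add_left)
  ultimately show "line q u = line r w"
    unfolding line_def by (intro equalityI image_subsetI) (metis rangeI)+
qed

text \<open>
  The component of the edge function at the edge \<open>{i, j}\<close>, where \<open>c\<close> is the line vertex. Points
  are placed by a vector indexed by the finite type of all potential vertices, to have a normed
  configuration space; its coordinates at indices other than point vertices are never used.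
\<close>

definition edge_fun ::
  "'v \<Rightarrow> 'v \<Rightarrow> 'v \<Rightarrow> (real^3)^'v::finite \<Rightarrow> (real^3) set \<Rightarrow> real" where
  "edge_fun c i j p l =
     (if i = c then (infdist (p $ j) l)\<^sup>2
      else if j = c then (infdist (p $ i) l)\<^sup>2
      else (dist (p $ i) (p $ j))\<^sup>2)"

definition in_kernel ::
  "'v \<Rightarrow> 'v set set \<Rightarrow> (real^3)^'v::finite \<Rightarrow> real^3 \<Rightarrow> real^3 \<Rightarrow>
   (real^3)^'v \<Rightarrow> real^3 \<Rightarrow> real^3 \<Rightarrow> bool" where
  "in_kernel c E p q u p' q' u' \<longleftrightarrow>
     (\<forall>i j. {i, j} \<in> E \<longrightarrow>
        frechet_derivative (\<lambda>(p, q, u). edge_fun c i j p (line q u)) (at (p, q, u)) (p', q', u') = 0)"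

text \<open>
  The infinitesimal isometry \<open>x \<mapsto> A x + b\<close>, with \<open>A\<close> skew-symmetric, moves the line through \<open>q\<close>
  with direction \<open>u\<close> with velocity represented by \<open>(A q + b, A u)\<close>.
\<close>

definition induced_by_isometry ::
  "'v set \<Rightarrow> (real^3)^'v::finite \<Rightarrow> real^3 \<Rightarrow> real^3 \<Rightarrow>
   (real^3)^'v \<Rightarrow> real^3 \<Rightarrow> real^3 \<Rightarrow> bool" where
  "induced_by_isometry Vp p q u p' q' u' \<longleftrightarrow>
     (\<exists>(A::real^3^3) b. transpose A = - A \<and>
        (\<forall>i\<in>Vp. p' $ i = A *v (p $ i) + b) \<and>
        (\<exists>\<alpha>. q' = A *v q + b + \<alpha> *\<^sub>R u) \<and>
        (\<exists>\<beta>. u' = A *v u + \<beta> *\<^sub>R u))"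

definition infinitesimally_rigid ::
  "'v set \<Rightarrow> 'v \<Rightarrow> 'v set set \<Rightarrow> (real^3)^'v::finite \<Rightarrow> (real^3) set \<Rightarrow> bool" where
  "infinitesimally_rigid Vp c E p l \<longleftrightarrow>
     (\<forall>q u. u \<noteq> 0 \<and> l = line q u \<longrightarrow>
        (\<forall>p' q' u'. in_kernel c E p q u p' q' u' \<longrightarrow> induced_by_isometry Vp p q u p' q' u'))"

definition minimally_infinitesimally_rigid ::
  "'v set \<Rightarrow> 'v \<Rightarrow> 'v set set \<Rightarrow> (real^3)^'v::finite \<Rightarrow> (real^3) set \<Rightarrow> bool" where
  "minimally_infinitesimally_rigid Vp c E p l \<longleftrightarrow>
     infinitesimally_rigid Vp c E p l \<and>
     (\<forall>e\<in>E. \<not> infinitesimally_rigid Vp c (E - {e}) p l)"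

text \<open>
  By the following lemmas \<open>frechet_derivative\<close> in \<open>in_kernel\<close> is the derivative whenever
  \<open>u \<noteq> 0\<close>, also at points lying on the line.
\<close>

lemma infdist_line:
  assumes "u \<noteq> 0"
  shows "(infdist x (line q u))\<^sup>2 = (x - q) \<bullet> (x - q) - ((x - q) \<bullet> u)\<^sup>2 / (u \<bullet> u)"
proof -
  define s where "s = ((x - q) \<bullet> u) / (u \<bullet> u)"
  have uu: "u \<bullet> u > 0" using assms by simp
  have *: "(dist x (q + t *\<^sub>R u))\<^sup>2
      = (x - q) \<bullet> (x - q) - ((x - q) \<bullet> u)\<^sup>2 / (u \<bullet> u) + (t - s)\<^sup>2 * (u \<bullet> u)" for t
  proof -
    have "(dist x (q + t *\<^sub>R u))\<^sup>2 = ((x - q) - t *\<^sub>R u) \<bullet> ((x - q) - t *\<^sub>R u)"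
      by (simp add: dist_norm power2_norm_eq_inner diff_diff_eq)
    also have "\<dots> = (x - q) \<bullet> (x - q) - 2 * t * ((x - q) \<bullet> u) + t\<^sup>2 * (u \<bullet> u)"
      unfolding inner_diff_left[of "x - q"] inner_diff_right[of _ "x - q"]
      by (simp add: inner_commute power2_eq_square del: inner_diff_left inner_diff_right)
    also have "(x - q) \<bullet> u = s * (u \<bullet> u)" using uu by (simp add: s_def)
    finally show ?thesis
      using uu \<open>(x - q) \<bullet> u = s * (u \<bullet> u)\<close>
      by (simp add: power2_eq_square field_simps)
  qed
  have "infdist x (line q u) = dist x (q + s *\<^sub>R u)"
  proof (rule antisym)
    show "infdist x (line q u) \<le> dist x (q + s *\<^sub>R u)"
      by (rule infdist_le) (auto simp: line_def)
    have "dist x (q + s *\<^sub>R u) \<le> dist x (q + t *\<^sub>R u)" for t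
      by (rule power2_le_imp_le) (use uu in \<open>auto simp: *\<close>)
    then show "dist x (q + s *\<^sub>R u) \<le> infdist x (line q u)"
      unfolding infdist_def line_def by (auto intro!: cINF_greatest)
  qed
  then show ?thesis by (simp add: *)
qed

lemma edge_fun_differentiable:
  fixes p :: "(real^3)^'v::finite"
  assumes "u \<noteq> 0"
  shows "(\<lambda>(p, q, u). edge_fun c i j p (line q u)) differentiable at (p, q, u)"
proof -
  have nth: "(\<lambda>z :: ((real^3)^'v) \<times> (real^3) \<times> (real^3). fst z $ k) differentiable at (p, q, u)" for k
    by (rule bounded_linear_imp_differentiable)
      (rule bounded_linear_compose[OF bounded_linear_vec_nth bounded_linear_fst])
  have fq: "(\<lambda>z :: ((real^3)^'v) \<times> (real^3) \<times> (real^3). fst (snd z)) differentiable at (p, q, u)"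
    by (rule bounded_linear_imp_differentiable)
      (rule bounded_linear_compose[OF bounded_linear_fst bounded_linear_snd])
  have fu: "(\<lambda>z :: ((real^3)^'v) \<times> (real^3) \<times> (real^3). snd (snd z)) differentiable at (p, q, u)"
    by (rule bounded_linear_imp_differentiable)
      (rule bounded_linear_compose[OF bounded_linear_snd bounded_linear_snd])
  let ?U = "{z :: ((real^3)^'v) \<times> (real^3) \<times> (real^3). snd (snd z) \<noteq> 0}"
  have op: "open ?U"
    by (intro open_Collect_neq continuous_intros)
  have pl: "(\<lambda>z :: ((real^3)^'v) \<times> (real^3) \<times> (real^3).
      (infdist (fst z $ k) (line (fst (snd z)) (snd (snd z))))\<^sup>2) differentiable at (p, q, u)" for k
  proof -
    let ?d = "\<lambda>z :: ((real^3)^'v) \<times> (real^3) \<times> (real^3). fst z $ k - fst (snd z)"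
    have "(\<lambda>z. ?d z \<bullet> ?d z - (?d z \<bullet> snd (snd z))\<^sup>2 / (snd (snd z) \<bullet> snd (snd z)))
        differentiable at (p, q, u)"
      by (intro differentiable_diff differentiable_divide differentiable_power
          differentiable_inner nth fq fu) (use assms in simp)
    then obtain D where D: "((\<lambda>z. ?d z \<bullet> ?d z - (?d z \<bullet> snd (snd z))\<^sup>2 / (snd (snd z) \<bullet> snd (snd z)))
        has_derivative D) (at (p, q, u))"
      unfolding differentiable_def by blast
    have "((\<lambda>z. (infdist (fst z $ k) (line (fst (snd z)) (snd (snd z))))\<^sup>2) has_derivative D)
        (at (p, q, u))"
      by (rule has_derivative_transform_within_open[OF D op]) (use assms in \<open>auto simp: infdist_line\<close>)
    then show ?thesis unfolding differentiable_def by blast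
  qed
  have pp: "(\<lambda>z :: ((real^3)^'v) \<times> (real^3) \<times> (real^3). (dist (fst z $ i) (fst z $ j))\<^sup>2)
      differentiable at (p, q, u)"
    unfolding dist_norm power2_norm_eq_inner
    by (intro differentiable_inner differentiable_diff nth)
  show ?thesis
    unfolding edge_fun_def case_prod_beta
    by (cases "i = c"; cases "j = c") (use pl pp in simp_all)
qed

end

theory Submission
  imports Defs
begin

text \<open>
  Both sides say that the graph on the points alone is (2,2)-tight: it has \<open>2 n - 2\<close> edges on its \<open>n\<close>
  vertices, and every nonempty set \<open>X\<close> of vertices spans at most \<open>2 |X| - 2\<close> edges.

  For maximal independence this is arithmetic. A set \<open>X\<close> of points together with the line carries
  \<open>|X|\<close> edges to the line, so the bound \<open>6\<close> leaves \<open>2 |X| - 2\<close> edges between the points of \<open>X\<close>.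
  Subgraphs without the line obey their bound \<open>3 |X| - 6\<close> automatically, because
  \<open>2 |X| - 2 \<le> 3 |X| - 6\<close> for \<open>|X| \<ge> 4\<close>, and the graph is simple (\<open>tight_iff_maximally_independent\<close>).

  For rigidity, an infinitesimal isometry can be subtracted from any motion so that the line stays
  fixed. If \<open>h\<^sub>i\<close> is the perpendicular from the line, with direction \<open>u\<close>, to the point \<open>p\<^sub>i\<close>, and
  \<open>h\<^sub>i \<noteq> 0\<close>, then \<open>p\<^sub>i\<close> keeps its distance to the line exactly if its velocity is
  \<open>\<alpha>\<^sub>i (h\<^sub>i \<times> u) + \<beta>\<^sub>i u\<close>, a rotation about the line and a translation along it. An edge \<open>ij\<close> becomes
  \<open>a\<^sub>i\<^sub>j (\<alpha>\<^sub>i - \<alpha>\<^sub>j) + b\<^sub>i\<^sub>j (\<beta>\<^sub>i - \<beta>\<^sub>j) = 0\<close> with \<open>a\<^sub>i\<^sub>j = u \<bullet> (h\<^sub>i \<times> h\<^sub>j)\<close> and \<open>b\<^sub>i\<^sub>j\<close> proportional to the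
  difference of heights, and the framework is rigid iff all solutions are constant
  (\<open>infinitesimally_rigid_iff_dir_rigid\<close>). This system has \<open>2 n\<close> unknowns and a trivial space of
  solutions of dimension \<open>2\<close>, so minimal rigidity forces tightness (\<open>tight_if_minimally_rigid\<close>).

  The main point is to place the points of a given simple tight graph so that the system has only
  constant solutions (\<open>tight_realisable\<close>). With coordinates \<open>(X, Y, Z)\<close> and the \<open>z\<close>-axis as the line,
  the equation of \<open>ij\<close> has the slope \<open>a\<^sub>i\<^sub>j / b\<^sub>i\<^sub>j = (X\<^sub>i Y\<^sub>j - X\<^sub>j Y\<^sub>i) / (Z\<^sub>i - Z\<^sub>j)\<close>. The proof removes a vertex
  \<open>v\<close> of degree 2 or 3. Degree 2 is easy: two edges at \<open>v\<close> with different slopes determine \<open>v\<close>. For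
  degree 3, if the edges \<open>vx\<close> and \<open>vy\<close> have the same slope \<open>s\<close>, their difference is an equation of
  slope \<open>s\<close> for the pair \<open>xy\<close>. Conversely, for any number \<open>s\<close> and any height of \<open>v\<close>, the demand that both
  \<open>vx\<close> and \<open>vy\<close> have slope \<open>s\<close> is a uniquely solvable linear system for the other two coordinates of \<open>v\<close>.
  So \<open>v\<close> can be exchanged for an edge \<open>xy\<close> whose slope is an arbitrary number, unrelated to the positions
  of \<open>x\<close> and \<open>y\<close>. Such an edge may even be parallel to an edge that is already there. The induction
  therefore runs over tight multigraphs in which some edges are geometric, with slopes given by the
  positions, while the others have slopes that may be chosen freely; only the geometric edges have
  to be simple. Uncrossing tight sets shows that two of the three neighbours of \<open>v\<close> can be joined
  (\<open>star_reducible_pair\<close>). Since uniqueness of solutions is an open condition on the slopes, general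
  position can be restored by a small perturbation between two steps (\<open>realises_general_position\<close>).

  Minimality follows by counting for edges between points. If instead the constraint between the line
  and \<open>p\<^sub>i\<close> is dropped, the velocity \<open>h\<^sub>i\<close> of \<open>p\<^sub>i\<close> can be completed to a motion, as independence of the
  remaining equations makes the system solvable for every right-hand side
  (\<open>not_rigid_without_line_edge\<close>).
\<close>

section \<open>Tight multigraphs and their reductions\<close>

text \<open>
  A multigraph is a set \<open>E\<close> of labels whose ends are \<open>f e\<close> and \<open>g e\<close>. Labels allow parallel edges, and
  an edge can be moved by updating \<open>f\<close> and \<open>g\<close> at its label.
\<close>

definition spanned :: "'e set \<Rightarrow> ('e \<Rightarrow> 'v) \<Rightarrow> ('e \<Rightarrow> 'v) \<Rightarrow> 'v set \<Rightarrow> 'e set" where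
  "spanned E f g X = {e \<in> E. f e \<in> X \<and> g e \<in> X}"

definition star :: "'e set \<Rightarrow> ('e \<Rightarrow> 'v) \<Rightarrow> ('e \<Rightarrow> 'v) \<Rightarrow> 'v \<Rightarrow> 'e set" where
  "star E f g v = {e \<in> E. f e = v \<or> g e = v}"

definition other_end :: "('e \<Rightarrow> 'v) \<Rightarrow> ('e \<Rightarrow> 'v) \<Rightarrow> 'v \<Rightarrow> 'e \<Rightarrow> 'v" where
  "other_end f g v e = (if f e = v then g e else f e)"

definition tight :: "'v set \<Rightarrow> 'e set \<Rightarrow> ('e \<Rightarrow> 'v) \<Rightarrow> ('e \<Rightarrow> 'v) \<Rightarrow> bool" where
  "tight V E f g \<longleftrightarrow> finite V \<and> finite E \<and> (\<forall>e\<in>E. f e \<in> V \<and> g e \<in> V \<and> f e \<noteq> g e) \<and>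
     card E + 2 = 2 * card V \<and>
     (\<forall>X\<subseteq>V. X \<noteq> {} \<longrightarrow> card (spanned E f g X) + 2 \<le> 2 * card X)"

lemma tightD:
  assumes "tight V E f g"
  shows "finite V" "finite E" "\<And>e. e \<in> E \<Longrightarrow> f e \<in> V" "\<And>e. e \<in> E \<Longrightarrow> g e \<in> V"
    "\<And>e. e \<in> E \<Longrightarrow> f e \<noteq> g e" "card E + 2 = 2 * card V"
    "\<And>X. X \<subseteq> V \<Longrightarrow> X \<noteq> {} \<Longrightarrow> card (spanned E f g X) + 2 \<le> 2 * card X"
  using assms unfolding tight_def by blast+

lemma ends_star: "e \<in> star E f g v \<Longrightarrow> {f e, g e} = {v, other_end f g v e}"
  by (auto simp: star_def other_end_def)

lemma other_end_in:
  assumes "tight V E f g" "e \<in> star E f g v"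
  shows "other_end f g v e \<in> V - {v}"
  using assms tightD(3,4)[OF assms(1), of e] tightD(5)[OF assms(1), of e]
  by (auto simp: star_def other_end_def)

lemma finite_spanned [simp]: "finite E \<Longrightarrow> finite (spanned E f g X)"
  by (simp add: spanned_def)

lemma finite_star [simp]: "finite E \<Longrightarrow> finite (star E f g v)"
  by (simp add: star_def)

lemma card_star_spanned:
  assumes "tight V E f g"
  shows "card (star E f g v) + card (spanned E f g (V - {v})) = card E"
proof -
  have "E = star E f g v \<union> spanned E f g (V - {v})"
    using tightD(3,4)[OF assms] by (auto simp: star_def spanned_def)
  moreover have "star E f g v \<inter> spanned E f g (V - {v}) = {}"
    by (auto simp: star_def spanned_def)
  ultimately show ?thesis
    using tightD(2)[OF assms] by (metis card_Un_disjoint finite_spanned finite_star)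
qed

lemma sum_card_star:
  assumes "tight V E f g"
  shows "(\<Sum>v\<in>V. card (star E f g v)) = 2 * card E"
proof -
  note t = tightD[OF assms]
  have "(\<Sum>v\<in>V. card (star E f g v)) = (\<Sum>v\<in>V. \<Sum>e\<in>E. if f e = v \<or> g e = v then 1 else 0)"
    using t(2) by (intro sum.cong) (auto simp: star_def sum.If_cases Int_def)
  also have "\<dots> = (\<Sum>e\<in>E. \<Sum>v\<in>V. if f e = v \<or> g e = v then 1 else 0)"
    by (rule sum.swap)
  also have "\<dots> = (\<Sum>e\<in>E. 2)"
  proof (rule sum.cong[OF refl])
    fix e assume e: "e \<in> E"
    have "(\<Sum>v\<in>V. if f e = v \<or> g e = v then 1 else 0::nat) = card (V \<inter> {v. f e = v \<or> g e = v})"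
      using t(1) by (simp add: sum.If_cases)
    also have "V \<inter> {v. f e = v \<or> g e = v} = {f e, g e}"
      using t(3,4)[OF e] by auto
    also have "card \<dots> = 2" using t(5)[OF e] by simp
    finally show "(\<Sum>v\<in>V. if f e = v \<or> g e = v then 1 else 0::nat) = 2" .
  qed
  finally show ?thesis by simp
qed

text \<open>
  The degrees sum to \<open>2 |E| = 4 |V| - 4\<close>, so some degree is below 4. No degree is below 2, as the
  count for the complement of a vertex leaves at least two edges at it.
\<close>

lemma tight_small_star:
  assumes "tight V E f g" "card V \<ge> 2"
  shows "\<exists>v\<in>V. card (star E f g v) = 2 \<or> card (star E f g v) = 3"
proof (rule ccontr)
  assume neg: "\<not> ?thesis"
  note t = tightD[OF assms(1)]
  have "card (star E f g v) \<ge> 4" if v: "v \<in> V" for v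
  proof -
    have c: "card (V - {v}) = card V - 1" using v t(1) by simp
    then have "V - {v} \<noteq> {}" using assms(2) by force
    then have "card (spanned E f g (V - {v})) + 2 \<le> 2 * (card V - 1)"
      using t(7)[of "V - {v}"] c by auto
    then have "card (star E f g v) \<ge> 2"
      using card_star_spanned[OF assms(1), of v] t(6) assms(2) by linarith
    moreover have "card (star E f g v) \<noteq> 2" "card (star E f g v) \<noteq> 3" using neg v by blast+
    ultimately show ?thesis by linarith
  qed
  then have "(\<Sum>v\<in>V. 4) \<le> (\<Sum>v\<in>V. card (star E f g v))"
    by (intro sum_mono) auto
  then show False using sum_card_star[OF assms(1)] t(6) by simp
qed

text \<open>
  The number of spanned edges is supermodular and \<open>X \<mapsto> 2 |X| - 2\<close> is modular on intersecting sets, so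
  tight sets that meet have a tight union.
\<close>

lemma spanned_uncross:
  assumes t: "tight V E f g" and XY: "X \<subseteq> V" "Y \<subseteq> V" "X \<inter> Y \<noteq> {}"
    and X: "card (spanned E f g X) + 2 \<ge> 2 * card X"
    and Y: "card (spanned E f g Y) + 2 \<ge> 2 * card Y"
  shows "card (spanned E f g (X \<union> Y)) + 2 \<ge> 2 * card (X \<union> Y)"
proof -
  note td = tightD[OF t]
  have fin: "finite X" "finite Y" using XY td(1) finite_subset by blast+
  have "card (spanned E f g X) + card (spanned E f g Y)
      = card (spanned E f g X \<union> spanned E f g Y) + card (spanned E f g X \<inter> spanned E f g Y)"
    by (rule card_Un_Int) (use td(2) in simp_all)
  also have "spanned E f g X \<inter> spanned E f g Y = spanned E f g (X \<inter> Y)"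
    by (auto simp: spanned_def)
  also have "card (spanned E f g X \<union> spanned E f g Y) \<le> card (spanned E f g (X \<union> Y))"
    by (rule card_mono) (use td(2) in \<open>auto simp: spanned_def\<close>)
  finally have "card (spanned E f g X) + card (spanned E f g Y)
      \<le> card (spanned E f g (X \<union> Y)) + card (spanned E f g (X \<inter> Y))" by simp
  moreover have "card (spanned E f g (X \<inter> Y)) + 2 \<le> 2 * card (X \<inter> Y)"
    using td(7)[of "X \<inter> Y"] XY by blast
  moreover have "card X + card Y = card (X \<union> Y) + card (X \<inter> Y)"
    using fin by (rule card_Un_Int)
  ultimately show ?thesis using X Y by linarith
qed

text \<open>
  A tight set containing all neighbours of a vertex of degree 3 would become overfull by adding the
  vertex.
\<close>

lemma no_tight_set_around_vertex:
  assumes t: "tight V E f g" and v: "v \<in> V" and X: "X \<subseteq> V - {v}"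
    and star: "card (star E f g v) = 3" "\<And>e. e \<in> star E f g v \<Longrightarrow> other_end f g v e \<in> X"
    and tX: "card (spanned E f g X) + 2 \<ge> 2 * card X"
  shows False
proof -
  note td = tightD[OF t]
  have fin: "finite X" using X td(1) finite_subset by blast
  have "spanned E f g X \<union> star E f g v \<subseteq> spanned E f g (insert v X)"
  proof (intro Un_least subsetI)
    fix e assume e: "e \<in> star E f g v"
    show "e \<in> spanned E f g (insert v X)"
      using ends_star[OF e] star(2)[OF e] e by (auto simp: spanned_def star_def doubleton_eq_iff)
  qed (auto simp: spanned_def)
  then have "card (spanned E f g X \<union> star E f g v) \<le> card (spanned E f g (insert v X))"
    using td(2) by (intro card_mono) auto
  moreover have "card (spanned E f g X \<union> star E f g v) = card (spanned E f g X) + card (star E f g v)"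
    by (rule card_Un_disjoint) (use td(2) X in \<open>auto simp: spanned_def star_def\<close>)
  moreover have "card (spanned E f g (insert v X)) + 2 \<le> 2 * card (insert v X)"
    using td(7)[of "insert v X"] X v by blast
  moreover have "card (insert v X) = Suc (card X)" using fin X by (subst card_insert_disjoint) auto
  ultimately show False using star(1) tX by linarith
qed

text \<open>
  If both \<open>e1, e2\<close> and \<open>e2, e3\<close> had their far ends in a tight set, these sets would meet in the end of
  \<open>e2\<close>, and their union would contradict \<open>no_tight_set_around_vertex\<close>. The ends of the pair found are
  distinct because a single vertex is a tight set.
\<close>

lemma star_reducible_pair:
  assumes t: "tight V E f g" and v: "v \<in> V" and s3: "card (star E f g v) = 3"
  obtains e1 e2 e3 where "star E f g v = {e1, e2, e3}" "e1 \<noteq> e2" "e1 \<noteq> e3" "e2 \<noteq> e3"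
    "other_end f g v e1 \<noteq> other_end f g v e2"
    "\<forall>X. X \<subseteq> V - {v} \<longrightarrow> other_end f g v e1 \<in> X \<longrightarrow> other_end f g v e2 \<in> X \<longrightarrow>
       card (spanned E f g X) + 2 < 2 * card X"
proof -
  note td = tightD[OF t]
  obtain e1 e2 e3 where e: "star E f g v = {e1, e2, e3}" "e1 \<noteq> e2" "e1 \<noteq> e3" "e2 \<noteq> e3"
    using s3 by (metis card_3_iff)
  let ?o = "other_end f g v"
  have oV: "?o x \<in> V - {v}" if "x \<in> star E f g v" for x
    using other_end_in[OF t that] .
  let ?free = "\<lambda>x y. \<forall>X. X \<subseteq> V - {v} \<longrightarrow> ?o x \<in> X \<longrightarrow> ?o y \<in> X \<longrightarrow>
    card (spanned E f g X) + 2 < 2 * card X"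
  have pair: "?free e1 e2 \<or> ?free e2 e3"
  proof (rule ccontr)
    assume "\<not> ?thesis"
    then have neg: "\<not> ?free e1 e2" "\<not> ?free e2 e3" by blast+
    obtain X where X: "X \<subseteq> V - {v}" "?o e1 \<in> X" "?o e2 \<in> X"
        "card (spanned E f g X) + 2 \<ge> 2 * card X"
      using neg(1) unfolding not_less[symmetric] by blast
    obtain Y where Y: "Y \<subseteq> V - {v}" "?o e2 \<in> Y" "?o e3 \<in> Y"
        "card (spanned E f g Y) + 2 \<ge> 2 * card Y"
      using neg(2) unfolding not_less[symmetric] by blast
    have "card (spanned E f g (X \<union> Y)) + 2 \<ge> 2 * card (X \<union> Y)"
      by (rule spanned_uncross[OF t]) (use X Y in auto)
    then show False
      using no_tight_set_around_vertex[OF t v, of "X \<union> Y"] X(1-3) Y(1-3) e(1) s3 by auto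
  qed
  have distinct: "?o x \<noteq> ?o y" if "?free x y" "x \<in> star E f g v" for x y
  proof
    assume "?o x = ?o y"
    moreover have "spanned E f g {?o x} = {}"
      using td(5) by (fastforce simp: spanned_def)
    ultimately show False using that(1)[rule_format, of "{?o x}"] oV[OF that(2)] by simp
  qed
  from pair show thesis
  proof
    assume fr: "?free e1 e2"
    show thesis
    proof (rule that[OF e])
      show "?o e1 \<noteq> ?o e2" using distinct[OF fr] e(1) by simp
    qed (use fr in simp)
  next
    assume fr: "?free e2 e3"
    have "star E f g v = {e2, e3, e1}" using e(1) by blast
    then show thesis
    proof (rule that)
      show "?o e2 \<noteq> ?o e3" using distinct[OF fr] e(1) by simp
    qed (use fr e(2-4) in simp_all)
  qed
qed

lemma tight_remove_vertex2:
  assumes t: "tight V E f g" and v: "v \<in> V" and s2: "card (star E f g v) = 2" and cV: "card V \<ge> 2"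
  shows "tight (V - {v}) (E - star E f g v) f g"
proof -
  note td = tightD[OF t]
  have sub: "star E f g v \<subseteq> E" by (auto simp: star_def)
  have "card (E - star E f g v) = card E - 2"
    using sub td(2) s2 by (simp add: card_Diff_subset)
  moreover have "card (V - {v}) = card V - 1" using v td(1) by simp
  moreover have "card (spanned (E - star E f g v) f g X) + 2 \<le> 2 * card X"
    if "X \<subseteq> V - {v}" "X \<noteq> {}" for X
  proof -
    have "spanned (E - star E f g v) f g X = spanned E f g X"
      using that by (auto simp: spanned_def star_def)
    then show ?thesis using td(7)[of X] that by auto
  qed
  ultimately show ?thesis
    unfolding tight_def using td(1-6) cV by (auto simp: star_def)
qed

text \<open>
  The label \<open>e1\<close> is reused for the new edge from \<open>x\<close> to \<open>y\<close>.
\<close>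

lemma tight_reduce_vertex3:
  assumes t: "tight V E f g" and v: "v \<in> V"
    and st: "star E f g v = {e1, e2, e3}" and ne: "e1 \<noteq> e2" "e1 \<noteq> e3" "e2 \<noteq> e3"
    and xy: "other_end f g v e1 = x" "other_end f g v e2 = y" "x \<noteq> y"
    and free: "\<And>X. X \<subseteq> V - {v} \<Longrightarrow> x \<in> X \<Longrightarrow> y \<in> X \<Longrightarrow> card (spanned E f g X) + 2 < 2 * card X"
  shows "tight (V - {v}) (E - {e2, e3}) (f(e1 := x)) (g(e1 := y))"
proof -
  note td = tightD[OF t]
  have eE: "e1 \<in> E" "e2 \<in> E" "e3 \<in> E" using st by (auto simp: star_def)
  have xyV: "x \<in> V - {v}" "y \<in> V - {v}"
    using other_end_in[OF t, of _ v] st xy by blast+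
  have c1: "card (E - {e2, e3}) + 2 = card E"
  proof -
    have "card {e2, e3} = 2" "{e2, e3} \<subseteq> E" using ne eE by auto
    moreover have "card {e2, e3} \<le> card E" using calculation td(2) by (intro card_mono) auto
    ultimately show ?thesis using td(2) by (simp add: card_Diff_subset)
  qed
  have c2: "card (V - {v}) + 1 = card V" using v td(1)
    by (metis Suc_eq_plus1 card.remove)
  have ends: "(f(e1 := x)) e \<in> V - {v} \<and> (g(e1 := y)) e \<in> V - {v} \<and> (f(e1 := x)) e \<noteq> (g(e1 := y)) e"
    if "e \<in> E - {e2, e3}" for e
  proof (cases "e = e1")
    case True then show ?thesis using xyV xy by simp
  next
    case False
    then have "e \<notin> star E f g v" using that st by auto
    then show ?thesis using that False td(3-5) by (auto simp: star_def)
  qed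
  have sp: "card (spanned (E - {e2, e3}) (f(e1 := x)) (g(e1 := y)) X) + 2 \<le> 2 * card X"
    if X: "X \<subseteq> V - {v}" "X \<noteq> {}" for X
  proof (cases "x \<in> X \<and> y \<in> X")
    case True
    have "spanned (E - {e2, e3}) (f(e1 := x)) (g(e1 := y)) X \<subseteq> insert e1 (spanned E f g X)"
      by (auto simp: spanned_def)
    then have "card (spanned (E - {e2, e3}) (f(e1 := x)) (g(e1 := y)) X) \<le> card (insert e1 (spanned E f g X))"
      by (intro card_mono) (use td(2) in auto)
    also have "\<dots> \<le> Suc (card (spanned E f g X))" by (rule card_insert_le_m1) auto
    finally show ?thesis using free[OF X(1)] True by force
  next
    case False
    then have "spanned (E - {e2, e3}) (f(e1 := x)) (g(e1 := y)) X \<subseteq> spanned E f g X"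
      by (auto simp: spanned_def split: if_splits)
    then have "card (spanned (E - {e2, e3}) (f(e1 := x)) (g(e1 := y)) X) \<le> card (spanned E f g X)"
      by (intro card_mono) (use td(2) in auto)
    then show ?thesis using td(7)[of X] X by force
  qed
  show ?thesis
    unfolding tight_def
  proof (intro conjI ballI allI impI)
    show "card (E - {e2, e3}) + 2 = 2 * card (V - {v})" using c1 c2 td(6) by linarith
  qed (use td(1,2) ends sp in auto)
qed

section \<open>Systems with prescribed edge slopes\<close>

text \<open>
  Each vertex has two unknowns \<open>\<alpha> i\<close> and \<open>\<beta> i\<close>, its angular velocity about the line and its velocity
  along the line, and \<open>(a e, b e)\<close> are the coefficients of the equation of the edge \<open>e\<close>. The constant
  solutions are the screw motions that fix the line.
\<close>

definition dir_rigid ::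
  "'v set \<Rightarrow> 'e set \<Rightarrow> ('e \<Rightarrow> 'v) \<Rightarrow> ('e \<Rightarrow> 'v) \<Rightarrow> ('e \<Rightarrow> real) \<Rightarrow> ('e \<Rightarrow> real) \<Rightarrow> bool" where
  "dir_rigid V E f g a b \<longleftrightarrow>
     (\<forall>\<alpha> \<beta>. (\<forall>e\<in>E. a e * (\<alpha> (f e) - \<alpha> (g e)) + b e * (\<beta> (f e) - \<beta> (g e)) = 0) \<longrightarrow>
        (\<forall>i\<in>V. \<forall>j\<in>V. \<alpha> i = \<alpha> j \<and> \<beta> i = \<beta> j))"

abbreviation slope_rigid :: "'v set \<Rightarrow> 'e set \<Rightarrow> ('e \<Rightarrow> 'v) \<Rightarrow> ('e \<Rightarrow> 'v) \<Rightarrow> ('e \<Rightarrow> real) \<Rightarrow> bool" where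
  "slope_rigid V E f g s \<equiv> dir_rigid V E f g s (\<lambda>_. 1)"

lemma dir_rigidD:
  assumes "dir_rigid V E f g a b" "i \<in> V" "j \<in> V"
    and "\<And>e. e \<in> E \<Longrightarrow> a e * (\<alpha> (f e) - \<alpha> (g e)) + b e * (\<beta> (f e) - \<beta> (g e)) = 0"
  shows "\<alpha> i = \<alpha> j" "\<beta> i = \<beta> j"
  using assms unfolding dir_rigid_def by blast+

text \<open>
  After one vertex is pinned, rigidity says that the sum of the absolute values of the equations is
  positive on the unit sphere. By compactness it is bounded below there, and a small change of the
  slopes changes it by less than this bound.
\<close>

lemma slope_rigid_open:
  fixes f g :: "'e \<Rightarrow> 'v::finite"
  assumes r: "slope_rigid V E f g s" and E: "finite E" "\<And>e. e \<in> E \<Longrightarrow> f e \<in> V \<and> g e \<in> V"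
  obtains \<epsilon> where "\<epsilon> > 0" "\<And>s'. (\<And>e. e \<in> E \<Longrightarrow> \<bar>s' e - s e\<bar> < \<epsilon>) \<Longrightarrow> slope_rigid V E f g s'"
proof (cases "V = {}")
  case True
  then show thesis using that[of 1] by (simp add: dir_rigid_def)
next
  case False
  then obtain o' where o': "o' \<in> V" by blast
  define S :: "((real^'v) \<times> (real^'v)) set" where
    "S = sphere 0 1 \<inter> (\<Inter>i\<in>insert o' (- V). {x. fst x $ i = 0} \<inter> {x. snd x $ i = 0})"
  define N where "N x = (\<Sum>e\<in>E. \<bar>s e * (fst x $ f e - fst x $ g e) + (snd x $ f e - snd x $ g e)\<bar>)"
    for x :: "(real^'v) \<times> (real^'v)"
  have S_iff: "x \<in> S \<longleftrightarrow> norm x = 1 \<and> (\<forall>i. i \<notin> V \<or> i = o' \<longrightarrow> fst x $ i = 0 \<and> snd x $ i = 0)" for x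
    by (auto simp: S_def)
  have cl: "closed (\<Inter>i\<in>insert o' (- V). {x :: (real^'v) \<times> (real^'v). fst x $ i = 0} \<inter> {x. snd x $ i = 0})"
    by (intro closed_INT ballI closed_Int closed_Collect_eq continuous_intros)
  have "compact S" unfolding S_def by (intro compact_Int_closed compact_sphere cl)
  have cont: "continuous_on S N"
    unfolding N_def by (intro continuous_intros)
  have pos: "N x > 0" if x: "x \<in> S" for x
  proof (rule ccontr)
    assume "\<not> N x > 0"
    moreover have "N x \<ge> 0" unfolding N_def by (intro sum_nonneg) auto
    ultimately have "N x = 0" by simp
    then have k: "s e * (fst x $ f e - fst x $ g e) + 1 * (snd x $ f e - snd x $ g e) = 0"
      if "e \<in> E" for e
      using that E(1) unfolding N_def by (simp add: sum_nonneg_eq_0_iff)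
    have "fst x $ i = 0 \<and> snd x $ i = 0" for i
      using dir_rigidD[OF r _ o', of i "\<lambda>i. fst x $ i" "\<lambda>i. snd x $ i"] k x unfolding S_iff
      by (cases "i \<in> V") auto
    then have "x = 0" by (simp add: prod_eq_iff vec_eq_iff)
    then show False using x S_iff by simp
  qed
  obtain m where m: "m > 0" "\<And>x. x \<in> S \<Longrightarrow> m \<le> N x"
  proof (cases "S = {}")
    case True then show thesis using that[of 1] by simp
  next
    case False
    then obtain x where "x \<in> S" "\<And>y. y \<in> S \<Longrightarrow> N x \<le> N y"
      using continuous_attains_inf[OF \<open>compact S\<close> False cont] by blast
    then show thesis using that[of "N x"] pos by blast
  qed
  \<comment> \<open>each of the \<open>|E|\<close> equations changes by at most \<open>2 \<epsilon>\<close>, as coordinates on the sphere are at most \<open>1\<close>\<close>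
  define \<epsilon> where "\<epsilon> = m / (2 * real (card E) + 1)"
  have e0: "\<epsilon> > 0" using m by (simp add: \<epsilon>_def)
  have em: "2 * real (card E) * \<epsilon> < m"
    using m(1) by (simp add: \<epsilon>_def field_simps)
  show thesis
  proof (rule that[OF e0])
    fix s' assume s': "\<And>e. e \<in> E \<Longrightarrow> \<bar>s' e - s e\<bar> < \<epsilon>"
    show "slope_rigid V E f g s'"
      unfolding dir_rigid_def
    proof (intro allI impI)
      fix \<alpha> \<beta> :: "'v \<Rightarrow> real"
      assume k: "\<forall>e\<in>E. s' e * (\<alpha> (f e) - \<alpha> (g e)) + 1 * (\<beta> (f e) - \<beta> (g e)) = 0"
      define y :: "(real^'v) \<times> (real^'v)" where
        "y = (\<chi> i. if i \<in> V then \<alpha> i - \<alpha> o' else 0, \<chi> i. if i \<in> V then \<beta> i - \<beta> o' else 0)"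
      have "y = 0"
      proof (rule ccontr)
        assume y: "y \<noteq> 0"
        define x where "x = (1 / norm y) *\<^sub>R y"
        have "norm x = 1" using y by (simp add: x_def)
        then have xS: "x \<in> S" using o' by (auto simp: S_iff x_def y_def)
        have le: "\<bar>s e * (fst x $ f e - fst x $ g e) + (snd x $ f e - snd x $ g e)\<bar> \<le> 2 * \<epsilon>"
          if e: "e \<in> E" for e
        proof -
          have "s' e * (fst y $ f e - fst y $ g e) + (snd y $ f e - snd y $ g e) = 0"
            using k e E(2)[OF e] by (simp add: y_def)
          then have "(1 / norm y) * (s' e * (fst y $ f e - fst y $ g e) + (snd y $ f e - snd y $ g e)) = 0"
            by simp
          then have "s' e * (fst x $ f e - fst x $ g e) + (snd x $ f e - snd x $ g e) = 0"
            by (simp add: x_def algebra_simps)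
          then have "s e * (fst x $ f e - fst x $ g e) + (snd x $ f e - snd x $ g e)
              = (s e - s' e) * (fst x $ f e - fst x $ g e)"
            by (simp add: algebra_simps)
          moreover have "\<bar>fst x $ i\<bar> \<le> 1" for i
          proof -
            have "\<bar>fst x $ i\<bar> \<le> norm (fst x)" by (rule component_le_norm_cart)
            also have "\<dots> \<le> norm x" by (metis norm_fst_le prod.collapse)
            finally show ?thesis using xS S_iff by simp
          qed
          from this[of "f e"] this[of "g e"] have "\<bar>fst x $ f e - fst x $ g e\<bar> \<le> 2"
            by linarith
          then have "\<bar>(s e - s' e) * (fst x $ f e - fst x $ g e)\<bar> \<le> \<epsilon> * 2"
            unfolding abs_mult using s'[OF e] e0 by (intro mult_mono) auto
          ultimately show ?thesis by simp
        qed
        have "N x \<le> real (card E) * (2 * \<epsilon>)"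
          unfolding N_def by (rule sum_bounded_above) (rule le)
        then show False using m(2)[OF xS] em by simp
      qed
      then have "\<alpha> i = \<alpha> o' \<and> \<beta> i = \<beta> o'" if "i \<in> V" for i
        using that by (auto simp: y_def prod_eq_iff vec_eq_iff split: if_splits)
      then show "\<forall>i\<in>V. \<forall>j\<in>V. \<alpha> i = \<alpha> j \<and> \<beta> i = \<beta> j" by simp
    qed
  qed
qed

section \<open>Realising tight multigraphs\<close>

definition det2 :: "('v \<Rightarrow> real) \<Rightarrow> ('v \<Rightarrow> real) \<Rightarrow> 'v \<Rightarrow> 'v \<Rightarrow> real" where
  "det2 X Y i j = X i * Y j - X j * Y i"

text \<open>
  \<open>M\<close> is the set of geometric edges. A point \<open>(X i, Y i, Z i)\<close> and the \<open>z\<close>-axis give the geometric edges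
  the slopes required here; the slopes of the other edges are unconstrained.
\<close>

definition realises ::
  "'v set \<Rightarrow> 'e set \<Rightarrow> 'e set \<Rightarrow> ('e \<Rightarrow> 'v) \<Rightarrow> ('e \<Rightarrow> 'v) \<Rightarrow>
   ('v \<Rightarrow> real) \<Rightarrow> ('v \<Rightarrow> real) \<Rightarrow> ('v \<Rightarrow> real) \<Rightarrow> ('e \<Rightarrow> real) \<Rightarrow> bool" where
  "realises V E M f g X Y Z s \<longleftrightarrow> slope_rigid V E f g s \<and> inj_on Z V \<and>
     (\<forall>e\<in>M. s e * (Z (f e) - Z (g e)) = det2 X Y (f e) (g e))"

text \<open>
  The last condition says that no three of the planar points \<open>(X i, Y i)\<close> are collinear.
\<close>

definition general_position :: "'v set \<Rightarrow> ('v \<Rightarrow> real) \<Rightarrow> ('v \<Rightarrow> real) \<Rightarrow> bool" where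
  "general_position V X Y \<longleftrightarrow> (\<forall>i\<in>V. X i \<noteq> 0) \<and>
     (\<forall>i\<in>V. \<forall>j\<in>V. i \<noteq> j \<longrightarrow> det2 X Y i j \<noteq> 0) \<and>
     (\<forall>i\<in>V. \<forall>j\<in>V. \<forall>k\<in>V. i \<noteq> j \<and> j \<noteq> k \<and> k \<noteq> i \<longrightarrow> det2 X Y i j + det2 X Y j k + det2 X Y k i \<noteq> 0)"

lemma eventually_quadratic_nonzero:
  fixes a b c :: real
  assumes "a \<noteq> 0 \<or> b \<noteq> 0"
  shows "\<forall>\<^sub>F t in at 0. a * t^2 + b * t + c \<noteq> 0"
proof -
  have "finite {t. poly [:c, b, a:] t = 0}"
    by (rule poly_roots_finite) (use assms in auto)
  then have "\<forall>\<^sub>F t in at 0. \<forall>r\<in>{t. poly [:c, b, a:] t = 0}. t \<noteq> r"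
    by (intro eventually_ball_finite) (auto intro: eventually_neq_at_within)
  then show ?thesis
    by eventually_elim (auto simp: algebra_simps power2_eq_square)
qed

text \<open>
  The planar points move along the directions \<open>(m, m\<^sup>2)\<close> for distinct \<open>m > 0\<close>. Every condition of general
  position is then the nonvanishing of a nonconstant polynomial of degree at most two in \<open>t\<close>: for
  collinearity of three points, its leading coefficient is a Vandermonde determinant. Thus all
  conditions hold for small \<open>t \<noteq> 0\<close>, while the slopes change continuously and rigidity is preserved.
\<close>

lemma realises_general_position:
  fixes f g :: "'e \<Rightarrow> 'v::finite"
  assumes r: "realises V E M f g X Y Z s" and M: "M \<subseteq> E" and E: "finite E"
    "\<And>e. e \<in> E \<Longrightarrow> f e \<in> V \<and> g e \<in> V \<and> f e \<noteq> g e"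
  obtains X' Y' s' where "realises V E M f g X' Y' Z s'" "general_position V X' Y'"
    "\<And>e. e \<in> E \<Longrightarrow> s' e \<noteq> 0"
proof -
  have sr: "slope_rigid V E f g s" and Z: "inj_on Z V"
    and geo: "\<And>e. e \<in> M \<Longrightarrow> s e * (Z (f e) - Z (g e)) = det2 X Y (f e) (g e)"
    using r unfolding realises_def by auto
  have Zne: "Z (f e) - Z (g e) \<noteq> 0" if "e \<in> E" for e
    using Z E(2)[OF that] by (auto dest: inj_onD)
  obtain n :: "'v \<Rightarrow> nat" where n: "inj n"
    using finite_imp_inj_to_nat_seg[of "UNIV :: 'v set"] by auto
  \<comment> \<open>distinct positive numbers, so that the leading coefficients below are nonzero\<close>
  define m where "m i = real (n i) + 1" for i
  have m0: "m i > 0" for i by (simp add: m_def)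
  have mne: "m i \<noteq> m j" if "i \<noteq> j" for i j using n that by (auto simp: m_def inj_def)
  define X1 where "X1 t i = X i + t * m i" for t i
  define Y1 where "Y1 t i = Y i + t * (m i)\<^sup>2" for t i
  define s1 where "s1 t e = (if e \<in> M then det2 (X1 t) (Y1 t) (f e) (g e) / (Z (f e) - Z (g e)) else s e + t)"
    for t e
  obtain \<epsilon> where eps: "\<epsilon> > 0" "\<And>s'. (\<And>e. e \<in> E \<Longrightarrow> \<bar>s' e - s e\<bar> < \<epsilon>) \<Longrightarrow> slope_rigid V E f g s'"
    using slope_rigid_open[OF sr E(1)] E(2) by metis
  have ev_x: "\<forall>\<^sub>F t in at 0. \<forall>i\<in>V. X1 t i \<noteq> 0"
  proof (intro eventually_ball_finite ballI)
    fix i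
    show "\<forall>\<^sub>F t in at 0. X1 t i \<noteq> 0"
      using eventually_quadratic_nonzero[of 0 "m i" "X i"] m0[of i]
      by (simp add: X1_def algebra_simps)
  qed simp
  have quad: "det2 (X1 t) (Y1 t) i j = (m i * m j * (m j - m i)) * t\<^sup>2
      + (X i * (m j)\<^sup>2 + m i * Y j - X j * (m i)\<^sup>2 - m j * Y i) * t + det2 X Y i j" for t i j
    by (simp add: det2_def X1_def Y1_def algebra_simps power2_eq_square)
  have ev_d: "\<forall>\<^sub>F t in at 0. \<forall>i\<in>V. \<forall>j\<in>V. i \<noteq> j \<longrightarrow> det2 (X1 t) (Y1 t) i j \<noteq> 0"
  proof (intro eventually_ball_finite ballI)
    fix i j
    show "\<forall>\<^sub>F t in at 0. i \<noteq> j \<longrightarrow> det2 (X1 t) (Y1 t) i j \<noteq> 0"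
    proof (cases "i = j")
      case False
      then have "m i * m j * (m j - m i) \<noteq> 0" using m0[of i] m0[of j] mne[OF False] by simp
      then have "\<forall>\<^sub>F t in at 0. det2 (X1 t) (Y1 t) i j \<noteq> 0"
        unfolding quad by (intro eventually_quadratic_nonzero disjI1)
      then show ?thesis by (rule eventually_mono) simp
    qed simp
  qed simp_all
  have ev_t: "\<forall>\<^sub>F t in at 0. \<forall>i\<in>V. \<forall>j\<in>V. \<forall>k\<in>V. i \<noteq> j \<and> j \<noteq> k \<and> k \<noteq> i \<longrightarrow>
      det2 (X1 t) (Y1 t) i j + det2 (X1 t) (Y1 t) j k + det2 (X1 t) (Y1 t) k i \<noteq> 0"
  proof (intro eventually_ball_finite ballI)
    fix i j k
    let ?a = "m i * m j * (m j - m i) + m j * m k * (m k - m j) + m k * m i * (m i - m k)"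
    let ?b = "\<lambda>i j. X i * (m j)\<^sup>2 + m i * Y j - X j * (m i)\<^sup>2 - m j * Y i"
    have eq: "det2 (X1 t) (Y1 t) i j + det2 (X1 t) (Y1 t) j k + det2 (X1 t) (Y1 t) k i
      = ?a * t\<^sup>2 + (?b i j + ?b j k + ?b k i) * t + (det2 X Y i j + det2 X Y j k + det2 X Y k i)" for t
      unfolding quad by (simp add: algebra_simps)
    have "?a = (m j - m i) * (m k - m j) * (m k - m i)"
      by (simp add: algebra_simps power2_eq_square)
    then have a: "?a \<noteq> 0" if "i \<noteq> j \<and> j \<noteq> k \<and> k \<noteq> i" using that mne[of i j] mne[of j k] mne[of k i] by simp
    show "\<forall>\<^sub>F t in at 0. i \<noteq> j \<and> j \<noteq> k \<and> k \<noteq> i \<longrightarrow>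
      det2 (X1 t) (Y1 t) i j + det2 (X1 t) (Y1 t) j k + det2 (X1 t) (Y1 t) k i \<noteq> 0"
    proof (cases "i \<noteq> j \<and> j \<noteq> k \<and> k \<noteq> i")
      case True
      then have "\<forall>\<^sub>F t in at 0.
          det2 (X1 t) (Y1 t) i j + det2 (X1 t) (Y1 t) j k + det2 (X1 t) (Y1 t) k i \<noteq> 0"
        unfolding eq using a by (intro eventually_quadratic_nonzero disjI1)
      then show ?thesis by (rule eventually_mono) simp
    next
      case False
      then show ?thesis by (intro always_eventually) blast
    qed
  qed simp_all
  have ev_s: "\<forall>\<^sub>F t in at 0. \<forall>e\<in>E. s e + t \<noteq> 0"
  proof (intro eventually_ball_finite ballI E(1))
    fix e
    show "\<forall>\<^sub>F t in at 0. s e + t \<noteq> 0"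
      using eventually_quadratic_nonzero[of 0 1 "s e"] by (simp add: algebra_simps)
  qed
  have ev_c: "\<forall>\<^sub>F t in at 0. \<forall>e\<in>E. \<bar>s1 t e - s e\<bar> < \<epsilon>"
  proof (intro eventually_ball_finite ballI E(1))
    fix e assume e: "e \<in> E"
    have "((\<lambda>t. s1 t e) \<longlongrightarrow> s1 0 e) (at 0)"
      unfolding s1_def det2_def X1_def Y1_def
      by (cases "e \<in> M") (use Zne[OF e] in \<open>auto intro!: tendsto_eq_intros\<close>)
    moreover have "s1 0 e = s e"
      using geo[of e] Zne[OF e] by (auto simp: s1_def det2_def X1_def Y1_def field_simps)
    ultimately show "\<forall>\<^sub>F t in at 0. \<bar>s1 t e - s e\<bar> < \<epsilon>"
      using eps(1) by (simp add: tendsto_iff dist_real_def)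
  qed
  obtain t where t: "\<forall>i\<in>V. X1 t i \<noteq> 0" "\<forall>i\<in>V. \<forall>j\<in>V. i \<noteq> j \<longrightarrow> det2 (X1 t) (Y1 t) i j \<noteq> 0"
    "\<forall>i\<in>V. \<forall>j\<in>V. \<forall>k\<in>V. i \<noteq> j \<and> j \<noteq> k \<and> k \<noteq> i \<longrightarrow>
      det2 (X1 t) (Y1 t) i j + det2 (X1 t) (Y1 t) j k + det2 (X1 t) (Y1 t) k i \<noteq> 0"
    "\<forall>e\<in>E. s e + t \<noteq> 0" "\<forall>e\<in>E. \<bar>s1 t e - s e\<bar> < \<epsilon>"
    using eventually_happens[OF eventually_conj[OF ev_x eventually_conj[OF ev_d
      eventually_conj[OF ev_t eventually_conj[OF ev_s ev_c]]]]] by auto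
  show thesis
  proof (rule that)
    show "general_position V (X1 t) (Y1 t)"
      unfolding general_position_def using t(1-3) by blast
    have "slope_rigid V E f g (s1 t)" by (rule eps(2)) (use t(5) in blast)
    then show "realises V E M f g (X1 t) (Y1 t) Z (s1 t)"
      unfolding realises_def using Z Zne M by (auto simp: s1_def)
    show "s1 t e \<noteq> 0" if "e \<in> E" for e
      using t(2,4) E(2)[OF that] Zne[OF that] that by (auto simp: s1_def)
  qed
qed

text \<open>
  Cramer's rule for the planar position \<open>(a, b)\<close> whose determinants with two independent points are
  prescribed, and the determinant with a further point that results.
\<close>

lemma solve_det2:
  assumes "det2 X Y x y \<noteq> 0"
  defines "a \<equiv> \<lambda>r1 r2. (r2 * X x - r1 * X y) / det2 X Y x y"
    and "b \<equiv> \<lambda>r1 r2. (r2 * Y x - r1 * Y y) / det2 X Y x y"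
  shows "a r1 r2 * Y x - X x * b r1 r2 = r1" "a r1 r2 * Y y - X y * b r1 r2 = r2"
    "(a r1 r2 * Y k - X k * b r1 r2) * det2 X Y x y = r1 * det2 X Y k y + r2 * det2 X Y x k"
proof -
  have *: "(a r1 r2 * u - w * b r1 r2) * det2 X Y x y
      = (r2 * X x - r1 * X y) * u - w * (r2 * Y x - r1 * Y y)" for u w
  proof -
    have "a r1 r2 * det2 X Y x y = r2 * X x - r1 * X y" "b r1 r2 * det2 X Y x y = r2 * Y x - r1 * Y y"
      using assms(1) by (simp_all add: a_def b_def)
    moreover have "(a r1 r2 * u - w * b r1 r2) * det2 X Y x y
        = (a r1 r2 * det2 X Y x y) * u - w * (b r1 r2 * det2 X Y x y)"
      by (simp add: left_diff_distrib)
    ultimately show ?thesis by simp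
  qed
  show "(a r1 r2 * Y k - X k * b r1 r2) * det2 X Y x y = r1 * det2 X Y k y + r2 * det2 X Y x k" for k
    unfolding * by (simp add: det2_def algebra_simps)
  from this[of x] this[of y] show "a r1 r2 * Y x - X x * b r1 r2 = r1" "a r1 r2 * Y y - X y * b r1 r2 = r2"
    using assms(1) by (simp_all add: det2_def)
qed

text \<open>
  The new vertex gets height \<open>z\<close> and planar position \<open>(a, b)\<close>. The Boolean parameters tell which of the
  three edges are geometric, since only these impose conditions. If \<open>k\<close> differs from \<open>x\<close> and \<open>y\<close>, then \<open>z\<close>
  is used to make the slope to \<open>k\<close> different: equality is an affine condition on \<open>z\<close> which is nontrivial
  because \<open>x\<close>, \<open>y\<close>, \<open>k\<close> are not collinear in the plane. If \<open>c3\<close> holds and \<open>k\<close> is \<open>x\<close> or \<open>y\<close>, then the edge to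
  that vertex which is to have slope \<open>s\<close> is not geometric, and the determinant there can be prescribed.
\<close>

lemma place_with_slopes:
  fixes X Y Z :: "'v \<Rightarrow> real"
  assumes fin: "finite V" and gp: "general_position V X Y" and V: "x \<in> V" "y \<in> V" "k \<in> V" "x \<noteq> y"
    and s: "s \<noteq> 0" and c: "c1 \<and> c3 \<Longrightarrow> k \<noteq> x" "c2 \<and> c3 \<Longrightarrow> k \<noteq> y"
  shows "\<exists>z a b. z \<notin> Z ` V \<and> (c1 \<longrightarrow> s * (z - Z x) = a * Y x - X x * b) \<and>
    (c2 \<longrightarrow> s * (z - Z y) = a * Y y - X y * b) \<and> (c3 \<longrightarrow> s * (z - Z k) \<noteq> a * Y k - X k * b)"
proof -
  define D where "D = det2 X Y x y"
  have D: "D \<noteq> 0" using gp V by (auto simp: general_position_def D_def)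
  define a where "a r1 r2 = (r2 * X x - r1 * X y) / D" for r1 r2
  define b where "b r1 r2 = (r2 * Y x - r1 * Y y) / D" for r1 r2
  note sol = solve_det2[of X Y x y, folded D_def, folded a_def b_def, OF D]
  have inf: "\<exists>z. z \<notin> Z ` V \<and> z \<noteq> z0" for z0
    using ex_new_if_finite[of "insert z0 (Z ` V)"] fin infinite_UNIV_char_0 by auto
  consider "k \<noteq> x" "k \<noteq> y" | "k = x" | "k = y" by blast
  then show ?thesis
  proof cases
    case 1
    define T where "T = det2 X Y x y + det2 X Y y k + det2 X Y k x"
    have T: "T \<noteq> 0" 
      unfolding T_def using gp V 1 by (auto simp: general_position_def)
    \<comment> \<open>the only height at which the slope to \<open>k\<close> is \<open>s\<close> as well\<close>
    define z0 where "z0 = (Z k * D - Z x * det2 X Y k y - Z y * det2 X Y x k) / T"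
    obtain z where z: "z \<notin> Z ` V" "z \<noteq> z0" using inf by blast
    let ?r1 = "s * (z - Z x)" and ?r2 = "s * (z - Z y)"
    have "s * (z - Z k) \<noteq> a ?r1 ?r2 * Y k - X k * b ?r1 ?r2"
    proof
      assume eq: "s * (z - Z k) = a ?r1 ?r2 * Y k - X k * b ?r1 ?r2"
      have "s * ((z - Z k) * D) = (s * (z - Z k)) * D" by simp
      also have "\<dots> = ?r1 * det2 X Y k y + ?r2 * det2 X Y x k"
        unfolding eq by (rule sol(3))
      also have "\<dots> = s * ((z - Z x) * det2 X Y k y + (z - Z y) * det2 X Y x k)"
        by (simp add: algebra_simps)
      finally have "(z - Z k) * D = (z - Z x) * det2 X Y k y + (z - Z y) * det2 X Y x k"
        using s by simp
      then have "z * T = Z k * D - Z x * det2 X Y k y - Z y * det2 X Y x k"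
        by (simp add: T_def D_def det2_def algebra_simps)
      then show False using z(2) T by (simp add: z0_def eq_divide_eq)
    qed
    then show ?thesis using z(1) sol(1,2)[of ?r1 ?r2]
      by (intro exI[of _ z] exI[of _ "a ?r1 ?r2"] exI[of _ "b ?r1 ?r2"]) simp
  next
    case 2
    obtain z where z: "z \<notin> Z ` V" using inf by blast
    \<comment> \<open>the shift by \<open>1\<close> makes the slope to \<open>x\<close> different from \<open>s\<close>\<close>
    let ?r1 = "s * (z - Z x) + (if c3 then 1 else 0)" and ?r2 = "s * (z - Z y)"
    show ?thesis using z sol(1,2)[of ?r1 ?r2] c(1) 2
      by (intro exI[of _ z] exI[of _ "a ?r1 ?r2"] exI[of _ "b ?r1 ?r2"]) auto
  next
    case 3
    obtain z where z: "z \<notin> Z ` V" using inf by blast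
    let ?r1 = "s * (z - Z x)" and ?r2 = "s * (z - Z y) + (if c3 then 1 else 0)"
    show ?thesis using z sol(1,2)[of ?r1 ?r2] c(2) 3
      by (intro exI[of _ z] exI[of _ "a ?r1 ?r2"] exI[of _ "b ?r1 ?r2"]) auto
  qed
qed

lemma place_with_two_slopes:
  fixes X Y Z :: "'v \<Rightarrow> real"
  assumes fin: "finite V" and gp: "general_position V X Y" and V: "x \<in> V" "y \<in> V"
    and c: "c1 \<and> c2 \<Longrightarrow> x \<noteq> y"
  shows "\<exists>z a b. z \<notin> Z ` V \<and> (c1 \<longrightarrow> s * (z - Z x) = a * Y x - X x * b) \<and>
    (c2 \<longrightarrow> t * (z - Z y) = a * Y y - X y * b)"
proof -
  obtain z where z: "z \<notin> Z ` V"
    using ex_new_if_finite[of "Z ` V"] fin infinite_UNIV_char_0 by auto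
  show ?thesis
  proof (cases "x = y")
    case True
    let ?b = "- (if c1 then s else t) * (z - Z x) / X x"
    have "X x \<noteq> 0" using gp V by (simp add: general_position_def)
    then show ?thesis using True c z
      by (intro exI[of _ z] exI[of _ 0] exI[of _ ?b]) auto
  next
    case False
    then have "det2 X Y x y \<noteq> 0" using gp V by (simp add: general_position_def)
    from solve_det2(1,2)[OF this] z show ?thesis by metis
  qed
qed

lemma ends_symmetric:
  fixes X Y Z \<alpha> \<beta> :: "'v \<Rightarrow> real"
  assumes "{p, q} = {v, x}"
  shows "s * (Z p - Z q) = det2 X Y p q \<longleftrightarrow> s * (Z v - Z x) = det2 X Y v x"
    "s * (\<alpha> p - \<alpha> q) + 1 * (\<beta> p - \<beta> q) = 0 \<longleftrightarrow> s * (\<alpha> v - \<alpha> x) + (\<beta> v - \<beta> x) = 0"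
proof -
  have "p = v \<and> q = x \<or> p = x \<and> q = v" using assms by (auto simp: doubleton_eq_iff)
  then show "s * (Z p - Z q) = det2 X Y p q \<longleftrightarrow> s * (Z v - Z x) = det2 X Y v x"
    by (auto simp: det2_def algebra_simps)
  from \<open>p = v \<and> q = x \<or> p = x \<and> q = v\<close>
  show "s * (\<alpha> p - \<alpha> q) + 1 * (\<beta> p - \<beta> q) = 0 \<longleftrightarrow> s * (\<alpha> v - \<alpha> x) + (\<beta> v - \<beta> x) = 0"
    by (auto simp: algebra_simps)
qed

text \<open>
  Two edges of different slopes from \<open>v\<close> to vertices that move together determine both unknowns of \<open>v\<close>.
\<close>

lemma slope_rigid_insert:
  assumes const: "\<And>\<alpha> \<beta> i j. (\<And>e. e \<in> E \<Longrightarrow> s e * (\<alpha> (f e) - \<alpha> (g e)) + 1 * (\<beta> (f e) - \<beta> (g e)) = 0)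
      \<Longrightarrow> i \<in> V \<Longrightarrow> j \<in> V \<Longrightarrow> \<alpha> i = \<alpha> j \<and> \<beta> i = \<beta> j"
    and e: "e1 \<in> E" "e2 \<in> E" "{f e1, g e1} = {v, x}" "{f e2, g e2} = {v, y}" "x \<in> V" "y \<in> V" "s e1 \<noteq> s e2"
  shows "slope_rigid (insert v V) E f g s"
  unfolding dir_rigid_def
proof (intro allI impI)
  fix \<alpha> \<beta> :: "'a \<Rightarrow> real"
  assume k: "\<forall>e\<in>E. s e * (\<alpha> (f e) - \<alpha> (g e)) + 1 * (\<beta> (f e) - \<beta> (g e)) = 0"
  have c: "\<alpha> i = \<alpha> x \<and> \<beta> i = \<beta> x" if "i \<in> V" for i
    by (rule const[OF _ that e(5)]) (use k in blast)
  have 1: "s e1 * (\<alpha> v - \<alpha> x) + (\<beta> v - \<beta> x) = 0"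
    using k e(1) ends_symmetric(2)[OF e(3), of "s e1" \<alpha> \<beta>] by blast
  have 2: "s e2 * (\<alpha> v - \<alpha> x) + (\<beta> v - \<beta> x) = 0"
    using k e(2) ends_symmetric(2)[OF e(4), of "s e2" \<alpha> \<beta>] c[OF e(6)] by simp
  from 1 2 have "(s e1 - s e2) * (\<alpha> v - \<alpha> x) = 0" by (simp add: algebra_simps)
  then have "\<alpha> v = \<alpha> x" using e(7) by simp
  moreover with 1 have "\<beta> v = \<beta> x" by simp
  ultimately show "\<forall>i\<in>insert v V. \<forall>j\<in>insert v V. \<alpha> i = \<alpha> j \<and> \<beta> i = \<beta> j"
    using c by (metis insert_iff)
qed

text \<open>
  Only the geometric edges are required to be pairwise non-parallel. This makes the statement stable
  under replacing a vertex of degree 3 by an edge, which is added as a non-geometric one.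
\<close>

theorem tight_realisable:
  fixes f g :: "'e \<Rightarrow> 'v::finite"
  assumes "tight V E f g" "M \<subseteq> E" "inj_on (\<lambda>e. {f e, g e}) M"
  shows "\<exists>X Y Z s. realises V E M f g X Y Z s"
  using assms
proof (induction "card V" arbitrary: V E f g M rule: less_induct)
  case less
  note t = less.prems(1)
  note td = tightD[OF t]
  show ?case
  proof (cases "card V \<ge> 2")
    case False
    then have "card V = 1" "card E = 0" using td(6) by linarith+
    then have c1: "card V = 1" "E = {}" using td(2) by auto
    then obtain v where "V = {v}" by (auto simp: card_1_singleton_iff)
    then have "realises V E M f g (\<lambda>_. 0) (\<lambda>_. 0) (\<lambda>_. 0) (\<lambda>_. 0)"
      using c1 less.prems(2) by (auto simp: realises_def dir_rigid_def)
    then show ?thesis by blast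
  next
    case True
    then obtain v where v: "v \<in> V" "card (star E f g v) = 2 \<or> card (star E f g v) = 3"
      using tight_small_star[OF t] by blast
    let ?V = "V - {v}" and ?M = "M - star E f g v" and ?o = "other_end f g v"
    have lt: "card ?V < card V" using v(1) td(1) by (metis card_Diff1_less)
    have V: "V = insert v ?V" using v(1) by blast
    have ends: "{f e, g e} = {v, ?o e}" "?o e \<in> ?V" if "e \<in> star E f g v" for e
      by (rule ends_star[OF that], rule other_end_in[OF t that])
    have away: "f e \<noteq> v" "g e \<noteq> v" if "e \<in> E" "e \<notin> star E f g v" for e
      using that by (auto simp: star_def)
    have oinj: "?o e \<noteq> ?o e'" if "e \<in> star E f g v" "e' \<in> star E f g v" "e \<in> M" "e' \<in> M" "e \<noteq> e'" for e e'
      using inj_onD[OF less.prems(3), of e e'] ends(1)[OF that(1)] ends(1)[OF that(2)] that by auto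
    have geo_new: "r * ((Z(v := z)) (f e) - (Z(v := z)) (g e)) = det2 (X(v := a)) (Y(v := b)) (f e) (g e)
        \<longleftrightarrow> r * (z - Z (?o e)) = a * Y (?o e) - X (?o e) * b"
      if "e \<in> star E f g v" for r Z z X Y a b e
      using ends_symmetric(1)[OF ends(1)[OF that], of r "Z(v := z)" "X(v := a)" "Y(v := b)"] ends(2)[OF that]
      by (auto simp: det2_def)
    have geo_old: "r * ((Z(v := z)) (f e) - (Z(v := z)) (g e)) = det2 (X(v := a)) (Y(v := b)) (f e) (g e)
        \<longleftrightarrow> r * (Z (f e) - Z (g e)) = det2 X Y (f e) (g e)"
      if "e \<in> E" "e \<notin> star E f g v" for r Z z X Y a b e
      using away[OF that] by (simp add: det2_def)
    have injZ: "inj_on (Z(v := z)) V" if "inj_on Z ?V" "z \<notin> Z ` ?V" for Z :: "'v \<Rightarrow> real" and z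
    proof -
      have "inj_on (Z(v := z)) (insert v ?V)" using that by (auto simp: inj_on_def)
      then show ?thesis unfolding V[symmetric] .
    qed
    show ?thesis
      using v(2)
    proof
      assume s2: "card (star E f g v) = 2"
      then obtain e1 e2 where e: "star E f g v = {e1, e2}" "e1 \<noteq> e2" by (meson card_2_iff)
      have st: "e1 \<in> star E f g v" "e2 \<in> star E f g v" using e by auto
      have stE: "e1 \<in> E" "e2 \<in> E" using st by (auto simp: star_def)
      have t': "tight ?V (E - star E f g v) f g"
        by (rule tight_remove_vertex2[OF t v(1) s2 True])
      note td' = tightD[OF t']
      have "\<exists>X Y Z s. realises ?V (E - star E f g v) ?M f g X Y Z s"
        by (rule less.hyps[OF lt t']) (use less.prems(2,3) in \<open>auto simp: inj_on_def\<close>)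
      then obtain X0 Y0 Z s0 where "realises ?V (E - star E f g v) ?M f g X0 Y0 Z s0" by blast
      then obtain X Y s where r: "realises ?V (E - star E f g v) ?M f g X Y Z s"
        and gp: "general_position ?V X Y"
        by (rule realises_general_position) (use less.prems(2) td' in auto)
      have rig: "slope_rigid ?V (E - star E f g v) f g s" and inj: "inj_on Z ?V"
        and geo: "\<And>e. e \<in> ?M \<Longrightarrow> s e * (Z (f e) - Z (g e)) = det2 X Y (f e) (g e)"
        using r unfolding realises_def by blast+
      obtain z a b where z: "z \<notin> Z ` ?V" "e1 \<in> M \<longrightarrow> 1 * (z - Z (?o e1)) = a * Y (?o e1) - X (?o e1) * b"
        "e2 \<in> M \<longrightarrow> 2 * (z - Z (?o e2)) = a * Y (?o e2) - X (?o e2) * b"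
        using place_with_two_slopes[OF _ gp, of "?o e1" "?o e2" "e1 \<in> M" "e2 \<in> M" Z 1 2]
          ends(2)[OF st(1)] ends(2)[OF st(2)] oinj[OF st _ _ e(2)] td'(1) by blast
      \<comment> \<open>any two different slopes would do\<close>
      let ?s = "s(e1 := 1, e2 := 2)"
      have old: "?s e = s e" if "e \<notin> star E f g v" for e using that e(1) by auto
      have "slope_rigid (insert v ?V) E f g ?s"
      proof (rule slope_rigid_insert[where ?e1.0 = e1 and ?e2.0 = e2 and x = "?o e1" and y = "?o e2"])
        fix \<alpha> \<beta> :: "'v \<Rightarrow> real" and i j
        assume k: "\<And>e. e \<in> E \<Longrightarrow> ?s e * (\<alpha> (f e) - \<alpha> (g e)) + 1 * (\<beta> (f e) - \<beta> (g e)) = 0"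
          and ij: "i \<in> ?V" "j \<in> ?V"
        have k': "s e * (\<alpha> (f e) - \<alpha> (g e)) + 1 * (\<beta> (f e) - \<beta> (g e)) = 0" if "e \<in> E - star E f g v" for e
          using k[of e] that old[of e] by simp
        show "\<alpha> i = \<alpha> j \<and> \<beta> i = \<beta> j"
          using dir_rigidD[OF rig ij, of \<alpha> \<beta>] k' by simp
      qed (use e ends[OF st(1)] ends[OF st(2)] stE in auto)
      moreover have "?s x * ((Z(v := z)) (f x) - (Z(v := z)) (g x)) = det2 (X(v := a)) (Y(v := b)) (f x) (g x)"
        if x: "x \<in> M" for x
      proof (cases "x \<in> star E f g v")
        case True
        then show ?thesis unfolding geo_new[OF True] using z(2,3) x e by auto
      next
        case False
        then have xM: "x \<in> ?M" "x \<in> E" using x less.prems(2) by auto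
        show ?thesis unfolding geo_old[OF xM(2) False] old[OF False] by (rule geo[OF xM(1)])
      qed
      moreover have "inj_on (Z(v := z)) V"
        by (rule injZ[OF inj z(1)])
      ultimately show ?thesis unfolding realises_def V[symmetric] by blast
    next
      assume s3: "card (star E f g v) = 3"
      obtain e1 e2 e3 where e: "star E f g v = {e1, e2, e3}" "e1 \<noteq> e2" "e1 \<noteq> e3" "e2 \<noteq> e3"
        and xy: "?o e1 \<noteq> ?o e2"
        and free: "\<forall>X. X \<subseteq> ?V \<longrightarrow> ?o e1 \<in> X \<longrightarrow> ?o e2 \<in> X \<longrightarrow>
          card (spanned E f g X) + 2 < 2 * card X"
        by (rule star_reducible_pair[OF t v(1) s3])
      have st: "e1 \<in> star E f g v" "e2 \<in> star E f g v" "e3 \<in> star E f g v" using e by auto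
      have stE: "e1 \<in> E" "e2 \<in> E" "e3 \<in> E" using st by (auto simp: star_def)
      let ?f = "f(e1 := ?o e1)" and ?g = "g(e1 := ?o e2)" and ?E = "E - {e2, e3}"
      have t': "tight ?V ?E ?f ?g"
        by (rule tight_reduce_vertex3[OF t v(1) e refl refl xy free[rule_format]])
      note td' = tightD[OF t']
      have "\<exists>X Y Z s. realises ?V ?E ?M ?f ?g X Y Z s"
        by (rule less.hyps[OF lt t']) (use less.prems(2,3) e in \<open>auto simp: inj_on_def\<close>)
      then obtain X0 Y0 Z s0 where "realises ?V ?E ?M ?f ?g X0 Y0 Z s0" by blast
      then obtain X Y s where r: "realises ?V ?E ?M ?f ?g X Y Z s"
        and gp: "general_position ?V X Y" and s0: "\<And>e. e \<in> ?E \<Longrightarrow> s e \<noteq> 0"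
        by (rule realises_general_position) (use less.prems(2) td'(2-5) e(1) in auto)
      have rig: "slope_rigid ?V ?E ?f ?g s" and inj: "inj_on Z ?V"
        and geo: "\<And>e. e \<in> ?M \<Longrightarrow> s e * (Z (?f e) - Z (?g e)) = det2 X Y (?f e) (?g e)"
        using r unfolding realises_def by blast+
      obtain z a b where z: "z \<notin> Z ` ?V" "e1 \<in> M \<longrightarrow> s e1 * (z - Z (?o e1)) = a * Y (?o e1) - X (?o e1) * b"
        "e2 \<in> M \<longrightarrow> s e1 * (z - Z (?o e2)) = a * Y (?o e2) - X (?o e2) * b"
        "e3 \<in> M \<longrightarrow> s e1 * (z - Z (?o e3)) \<noteq> a * Y (?o e3) - X (?o e3) * b"
        using place_with_slopes[OF td'(1) gp ends(2)[OF st(1)] ends(2)[OF st(2)] ends(2)[OF st(3)] xy,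
            of "s e1" "e1 \<in> M" "e3 \<in> M" "e2 \<in> M" Z]
          oinj[OF st(3) st(1)] oinj[OF st(3) st(2)] e s0[of e1] stE by blast
      have zk: "z - Z (?o e3) \<noteq> 0" using z(1) ends(2)[OF st(3)] by auto
      \<comment> \<open>the third slope is forced if \<open>e3\<close> is geometric; otherwise any value other than \<open>s e1\<close> is good\<close>
      define s3 where "s3 = (if e3 \<in> M then (a * Y (?o e3) - X (?o e3) * b) / (z - Z (?o e3)) else s e1 + 1)"
      have s3ne: "s e1 \<noteq> s3" using z(4) zk by (auto simp: s3_def nonzero_eq_divide_eq)
      let ?s = "s(e2 := s e1, e3 := s3)"
      have old: "?s x = s x" if "x \<notin> star E f g v" for x using that e(1) by auto
      have "slope_rigid (insert v ?V) E f g ?s"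
      proof (rule slope_rigid_insert[where ?e1.0 = e1 and ?e2.0 = e3 and x = "?o e1" and y = "?o e3"])
        fix \<alpha> \<beta> :: "'v \<Rightarrow> real" and i j
        assume k: "\<And>e. e \<in> E \<Longrightarrow> ?s e * (\<alpha> (f e) - \<alpha> (g e)) + 1 * (\<beta> (f e) - \<beta> (g e)) = 0"
          and ij: "i \<in> ?V" "j \<in> ?V"
        have k': "s x * (\<alpha> (?f x) - \<alpha> (?g x)) + 1 * (\<beta> (?f x) - \<beta> (?g x)) = 0" if x: "x \<in> ?E" for x
        proof (cases "x = e1")
          case True
          have "s e1 * (\<alpha> v - \<alpha> (?o e1)) + (\<beta> v - \<beta> (?o e1)) = 0"
            using k[OF stE(1)] ends_symmetric(2)[OF ends(1)[OF st(1)], of "s e1" \<alpha> \<beta>] e by simp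
          moreover have "s e1 * (\<alpha> v - \<alpha> (?o e2)) + (\<beta> v - \<beta> (?o e2)) = 0"
            using k[OF stE(2)] ends_symmetric(2)[OF ends(1)[OF st(2)], of "s e1" \<alpha> \<beta>] e by simp
          ultimately show ?thesis using True by (simp add: algebra_simps)
        next
          case False
          then show ?thesis using k[of x] x by simp
        qed
        show "\<alpha> i = \<alpha> j \<and> \<beta> i = \<beta> j"
          using dir_rigidD[OF rig ij, of \<alpha> \<beta>] k' by simp
      qed (use e ends[OF st(1)] ends[OF st(3)] stE s3ne in auto)
      moreover have "?s x * ((Z(v := z)) (f x) - (Z(v := z)) (g x)) = det2 (X(v := a)) (Y(v := b)) (f x) (g x)"
        if x: "x \<in> M" for x
      proof (cases "x \<in> star E f g v")
        case True
        then consider "x = e1" | "x = e2" | "x = e3" using e(1) by blast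
        then have "?s x * (z - Z (?o x)) = a * Y (?o x) - X (?o x) * b"
        proof cases
          case 3
          then show ?thesis using zk x by (simp add: s3_def)
        qed (use z(2,3) x e in auto)
        then show ?thesis unfolding geo_new[OF True] .
      next
        case False
        then have xM: "x \<in> ?M" "x \<in> E" "x \<noteq> e1" using x less.prems(2) e(1) by auto
        show ?thesis unfolding geo_old[OF xM(2) False] old[OF False] using geo[OF xM(1)] xM(3) by simp
      qed
      moreover have "inj_on (Z(v := z)) V"
        by (rule injZ[OF inj z(1)])
      ultimately show ?thesis unfolding realises_def V[symmetric] by blast
    qed
  qed
qed

section \<open>Counting equations\<close>

text \<open>
  Linear independence of the equations, expressed by a dual family: each equation is violated by an
  assignment that satisfies all the others.
\<close>

definition dir_independent ::
  "'e set \<Rightarrow> ('e \<Rightarrow> 'v) \<Rightarrow> ('e \<Rightarrow> 'v) \<Rightarrow> ('e \<Rightarrow> real) \<Rightarrow> ('e \<Rightarrow> real) \<Rightarrow> bool" where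
  "dir_independent E f g a b \<longleftrightarrow> (\<forall>e\<in>E. \<exists>\<alpha> \<beta>.
     (\<forall>e'\<in>E - {e}. a e' * (\<alpha> (f e') - \<alpha> (g e')) + b e' * (\<beta> (f e') - \<beta> (g e')) = 0) \<and>
     a e * (\<alpha> (f e) - \<alpha> (g e)) + b e * (\<beta> (f e) - \<beta> (g e)) \<noteq> 0)"

lemma dir_independent_duals:
  assumes "dir_independent E f g a b"
  obtains A B where "\<forall>e\<in>E. \<forall>e'\<in>E.
      a e' * (A e (f e') - A e (g e')) + b e' * (B e (f e') - B e (g e')) = 0 \<longleftrightarrow> e' \<noteq> e"
proof -
  obtain A B where *: "\<forall>e\<in>E. (\<forall>e'\<in>E - {e}.
      a e' * (A e (f e') - A e (g e')) + b e' * (B e (f e') - B e (g e')) = 0) \<and>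
     a e * (A e (f e) - A e (g e)) + b e * (B e (f e) - B e (g e)) \<noteq> 0"
    using assms unfolding dir_independent_def bchoice_iff by (elim exE)
  show thesis
  proof (rule that, intro ballI)
    fix e e' assume "e \<in> E" "e' \<in> E"
    then show "a e' * (A e (f e') - A e (g e')) + b e' * (B e (f e') - B e (g e')) = 0 \<longleftrightarrow> e' \<noteq> e"
      using * by (cases "e' = e") auto
  qed
qed

text \<open>
  With fewer than \<open>2 |V| - 2\<close> equations, some nonzero vector that vanishes at \<open>o'\<close> and off \<open>V\<close> is
  orthogonal to all coefficient vectors, and so is a nonconstant solution.
\<close>

lemma dir_rigid_card:
  fixes f g :: "'e \<Rightarrow> 'v::finite"
  assumes r: "dir_rigid V E f g a b" and E: "finite E" and o': "o' \<in> V"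
  shows "2 * card V \<le> card E + 2"
proof (rule ccontr)
  assume lt: "\<not> ?thesis"
  let ?U = "insert o' (- V)"
  define G :: "'e \<Rightarrow> (real^'v) \<times> (real^'v)" where
    "G e = (a e *\<^sub>R (axis (f e) 1 - axis (g e) 1), b e *\<^sub>R (axis (f e) 1 - axis (g e) 1))" for e
  define B :: "((real^'v) \<times> (real^'v)) set" where
    "B = G ` E \<union> ((\<lambda>i. (axis i 1, 0)) ` ?U \<union> (\<lambda>i. (0, axis i 1)) ` ?U)"
  have cU: "card ?U + card V = CARD('v) + 1"
  proof -
    have "card ?U = Suc (card (- V))" using o' by simp
    moreover have "card (- V) + card V = CARD('v)"
      using card_mono[of UNIV V] by (simp add: Compl_eq_Diff_UNIV card_Diff_subset)
    ultimately show ?thesis by simp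
  qed
  have "card B \<le> card E + (card ?U + card ?U)"
    unfolding B_def by (intro order_trans[OF card_Un_le] add_mono card_image_le E) auto
  moreover have "dim B \<le> card B"
    by (rule dim_le_card') (simp add: B_def E)
  ultimately have "dim B < DIM((real^'v) \<times> (real^'v))" using cU lt by simp
  then obtain x where x: "x \<noteq> 0" "\<And>y. y \<in> span B \<Longrightarrow> orthogonal x y"
    using orthogonal_to_subspace_exists by blast
  have B: "x \<bullet> y = 0" if "y \<in> B" for y
    using x(2)[OF span_base[OF that]] by (simp add: orthogonal_def)
  have U: "fst x $ i = 0" "snd x $ i = 0" if "i \<in> ?U" for i
  proof -
    have "(axis i 1, 0) \<in> B" "(0, axis i 1) \<in> B" using that unfolding B_def by blast+
    from B[OF this(1)] B[OF this(2)] show "fst x $ i = 0" "snd x $ i = 0"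
      by (simp_all add: inner_prod_def inner_axis)
  qed
  have "a e * (fst x $ f e - fst x $ g e) + b e * (snd x $ f e - snd x $ g e) = 0" if "e \<in> E" for e
  proof -
    have "G e \<in> B" using that by (simp add: B_def)
    from B[OF this] show ?thesis
      by (simp add: G_def inner_prod_def inner_diff_right inner_axis)
  qed
  then have "fst x $ i = 0 \<and> snd x $ i = 0" for i
    using dir_rigidD[OF r _ o', of i "\<lambda>i. fst x $ i" "\<lambda>i. snd x $ i"] U[of o'] U[of i]
    by (cases "i \<in> V") auto
  then have "x = 0" by (simp add: prod_eq_iff vec_eq_iff)
  with x(1) show False by simp
qed

text \<open>
  The dual assignments of the edges within \<open>X\<close>, shifted to vanish at one vertex of \<open>X\<close> and cut off
  outside \<open>X\<close>, still form a dual family. They are hence linearly independent in a space of dimension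
  \<open>2 (|X| - 1)\<close>.
\<close>

lemma dir_independent_spanned:
  fixes f g :: "'e \<Rightarrow> 'v::finite"
  assumes i: "dir_independent E f g a b" and E: "finite E" and X: "X \<noteq> {}"
  shows "card (spanned E f g X) + 2 \<le> 2 * card X"
proof -
  obtain o' where o': "o' \<in> X" using X by blast
  let ?F = "spanned E f g X" and ?X = "X - {o'}"
  obtain A B where AB: "\<forall>e\<in>E. \<forall>e'\<in>E.
      a e' * (A e (f e') - A e (g e')) + b e' * (B e (f e') - B e (g e')) = 0 \<longleftrightarrow> e' \<noteq> e"
    by (rule dir_independent_duals[OF i])
  define y :: "'e \<Rightarrow> (real^'v) \<times> (real^'v)" where
    "y e = (\<chi> i. if i \<in> X then A e i - A e o' else 0, \<chi> i. if i \<in> X then B e i - B e o' else 0)" for e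
  define \<phi> where "\<phi> e x = a e * (fst x $ f e - fst x $ g e) + b e * (snd x $ f e - snd x $ g e)"
    for e and x :: "(real^'v) \<times> (real^'v)"
  have phi_y: "\<phi> e' (y e) = a e' * (A e (f e') - A e (g e')) + b e' * (B e (f e') - B e (g e'))"
    if "e' \<in> ?F" for e e'
    using that by (simp add: \<phi>_def y_def spanned_def)
  have F: "e \<in> E" if "e \<in> ?F" for e using that by (simp add: spanned_def)
  have dual: "\<phi> e' (y e) = 0 \<longleftrightarrow> e' \<noteq> e" if "e \<in> ?F" "e' \<in> ?F" for e e'
    unfolding phi_y[OF that(2)] using AB F that by blast
  have "\<phi> e (x + x') = \<phi> e x + \<phi> e x'" "\<phi> e (c *\<^sub>R x) = c * \<phi> e x" "\<phi> e 0 = 0" for e x x' c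
    by (simp_all add: \<phi>_def algebra_simps)
  then have lin: "subspace {x. \<phi> e x = 0}" for e
    by (simp add: subspace_def)
  have inj: "inj_on y ?F" using dual by (metis inj_onI)
  have ind: "independent (y ` ?F)"
    unfolding dependent_def
  proof
    assume "\<exists>v\<in>y ` ?F. v \<in> span (y ` ?F - {v})"
    then obtain e where e: "e \<in> ?F" "y e \<in> span (y ` ?F - {y e})" by blast
    have "span (y ` ?F - {y e}) \<subseteq> {x. \<phi> e x = 0}"
      by (rule span_minimal[OF _ lin]) (use dual e(1) in auto)
    then show False using e dual by blast
  qed
  let ?B = "(\<lambda>i. (axis i 1, 0)) ` ?X \<union> (\<lambda>i. (0, axis i 1)) ` ?X :: ((real^'v) \<times> (real^'v)) set"
  have "y ` ?F \<subseteq> span ?B"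
  proof (rule image_subsetI)
    fix e
    have "y e = (\<Sum>i\<in>?X. (A e i - A e o') *\<^sub>R (axis i 1, 0)) + (\<Sum>i\<in>?X. (B e i - B e o') *\<^sub>R (0, axis i 1))"
      using o' by (auto simp: y_def prod_eq_iff vec_eq_iff fst_sum snd_sum axis_def if_distrib[of "(*) _"]
          sum.delta cong: if_cong)
    also have "\<dots> \<in> span ?B"
      by (intro span_add span_sum span_scale span_base) simp_all
    finally show "y e \<in> span ?B" .
  qed
  then have "card (y ` ?F) \<le> card ?B"
    using independent_span_bound[OF _ ind] by simp
  also have "card ?B \<le> card ?X + card ?X"
    by (intro order_trans[OF card_Un_le] add_mono card_image_le) auto
  also have "card (y ` ?F) = card ?F" by (rule card_image[OF inj])
  finally have "card ?F \<le> card ?X + card ?X" .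
  moreover have "card ?X + 1 = card X" using o' by (metis card.remove finite Suc_eq_plus1)
  ultimately show ?thesis by linarith
qed

lemma dir_independent_solvable:
  assumes i: "dir_independent E f g a b" and E: "finite E"
  shows "\<exists>\<alpha> \<beta>. \<forall>e\<in>E. a e * (\<alpha> (f e) - \<alpha> (g e)) + b e * (\<beta> (f e) - \<beta> (g e)) = r e"
proof -
  obtain A B where AB: "\<forall>e\<in>E. \<forall>e'\<in>E.
      a e' * (A e (f e') - A e (g e')) + b e' * (B e (f e') - B e (g e')) = 0 \<longleftrightarrow> e' \<noteq> e"
    by (rule dir_independent_duals[OF i])
  define v where "v e e' = a e' * (A e (f e') - A e (g e')) + b e' * (B e (f e') - B e (g e'))" for e e'
  define \<alpha> where "\<alpha> i = (\<Sum>e\<in>E. r e / v e e * A e i)" for i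
  define \<beta> where "\<beta> i = (\<Sum>e\<in>E. r e / v e e * B e i)" for i
  have "a e' * (\<alpha> (f e') - \<alpha> (g e')) + b e' * (\<beta> (f e') - \<beta> (g e')) = r e'" if e': "e' \<in> E" for e'
  proof -
    have "a e' * (\<alpha> (f e') - \<alpha> (g e')) + b e' * (\<beta> (f e') - \<beta> (g e')) = (\<Sum>e\<in>E. r e / v e e * v e e')"
      unfolding \<alpha>_def \<beta>_def sum_subtractf[symmetric] sum_distrib_left sum.distrib[symmetric]
      by (intro sum.cong refl) (simp add: v_def algebra_simps add_divide_distrib diff_divide_distrib)
    also have "\<dots> = (\<Sum>e\<in>E. if e = e' then r e' else 0)"
      by (intro sum.cong refl) (use AB e' in \<open>auto simp: v_def\<close>)
    also have "\<dots> = r e'" using E e' by simp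
    finally show ?thesis .
  qed
  then show ?thesis by blast
qed

lemma dir_independent_if_minimally_rigid:
  assumes r: "dir_rigid V E f g a b" and m: "\<And>e. e \<in> E \<Longrightarrow> \<not> dir_rigid V (E - {e}) f g a b"
  shows "dir_independent E f g a b"
  unfolding dir_independent_def
proof
  fix e assume e: "e \<in> E"
  obtain \<alpha> \<beta> i j where k: "\<forall>e'\<in>E - {e}. a e' * (\<alpha> (f e') - \<alpha> (g e')) + b e' * (\<beta> (f e') - \<beta> (g e')) = 0"
    and ij: "i \<in> V" "j \<in> V" "\<not> (\<alpha> i = \<alpha> j \<and> \<beta> i = \<beta> j)"
    using m[OF e] unfolding dir_rigid_def by blast
  have "a e * (\<alpha> (f e) - \<alpha> (g e)) + b e * (\<beta> (f e) - \<beta> (g e)) \<noteq> 0"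
  proof
    assume 0: "a e * (\<alpha> (f e) - \<alpha> (g e)) + b e * (\<beta> (f e) - \<beta> (g e)) = 0"
    have "a x * (\<alpha> (f x) - \<alpha> (g x)) + b x * (\<beta> (f x) - \<beta> (g x)) = 0" if "x \<in> E" for x
      using k 0 that by (cases "x = e") auto
    then show False using dir_rigidD[OF r ij(1,2), of \<alpha> \<beta>] ij(3) by blast
  qed
  with k show "\<exists>\<alpha> \<beta>. (\<forall>e'\<in>E - {e}. a e' * (\<alpha> (f e') - \<alpha> (g e')) + b e' * (\<beta> (f e') - \<beta> (g e')) = 0) \<and>
     a e * (\<alpha> (f e) - \<alpha> (g e)) + b e * (\<beta> (f e) - \<beta> (g e)) \<noteq> 0" by blast
qed

lemma tight_if_minimally_rigid:
  fixes f g :: "'e \<Rightarrow> 'v::finite"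
  assumes r: "dir_rigid V E f g a b" and m: "\<And>e. e \<in> E \<Longrightarrow> \<not> dir_rigid V (E - {e}) f g a b"
    and E: "finite E" "\<And>e. e \<in> E \<Longrightarrow> f e \<in> V \<and> g e \<in> V \<and> f e \<noteq> g e" and V: "V \<noteq> {}"
  shows "tight V E f g"
proof -
  have i: "dir_independent E f g a b" by (rule dir_independent_if_minimally_rigid[OF r m])
  note s = dir_independent_spanned[OF i E(1)]
  obtain o' where o': "o' \<in> V" using V by blast
  have "spanned E f g V = E" using E(2) by (auto simp: spanned_def)
  then have "card E + 2 = 2 * card V"
    using s[OF V] dir_rigid_card[OF r E(1) o'] by simp
  then show ?thesis unfolding tight_def using E s by auto
qed

lemma tight_rigid_remove_edge:
  fixes f g :: "'e \<Rightarrow> 'v::finite"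
  assumes t: "tight V E f g" and e: "e \<in> E"
  shows "\<not> dir_rigid V (E - {e}) f g a b"
proof
  assume r: "dir_rigid V (E - {e}) f g a b"
  note td = tightD[OF t]
  have "card (E - {e}) + 1 = card E" using e td(2) by (metis Suc_eq_plus1 card.remove)
  then show False using dir_rigid_card[OF r _ td(3)[OF e]] td(2,6) by simp
qed

section \<open>Derivatives of the squared distances\<close>

text \<open>
  A point is decomposed along the line: \<open>q + height q u x *\<^sub>R u\<close> is the foot of the perpendicular
  from \<open>x\<close>, and \<open>perp q u x\<close> is the vector from the foot to \<open>x\<close>.
\<close>

definition height :: "real^3 \<Rightarrow> real^3 \<Rightarrow> real^3 \<Rightarrow> real" where
  "height q u x = ((x - q) \<bullet> u) / (u \<bullet> u)"

definition perp :: "real^3 \<Rightarrow> real^3 \<Rightarrow> real^3 \<Rightarrow> real^3" where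
  "perp q u x = x - q - height q u x *\<^sub>R u"

lemma perp_orthogonal [simp]: "u \<noteq> 0 \<Longrightarrow> perp q u x \<bullet> u = 0" "u \<noteq> 0 \<Longrightarrow> u \<bullet> perp q u x = 0"
  by (simp_all add: perp_def height_def inner_diff_left inner_diff_right inner_commute)

lemma perp_eq_0_iff:
  assumes "u \<noteq> 0"
  shows "perp q u x = 0 \<longleftrightarrow> x \<in> line q u"
proof
  assume "perp q u x = 0"
  then have "x = q + height q u x *\<^sub>R u" by (simp add: perp_def algebra_simps)
  then show "x \<in> line q u" unfolding line_def by blast
next
  assume "x \<in> line q u"
  then obtain t where "x = q + t *\<^sub>R u" unfolding line_def by blast
  then show "perp q u x = 0" using assms by (simp add: perp_def height_def)
qed

lemma frechet_derivative_point_point: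
  fixes p p' :: "(real^3)^'v::finite"
  shows "frechet_derivative (\<lambda>(p :: (real^3)^'v, q :: real^3, u :: real^3). (dist (p $ i) (p $ j))\<^sup>2)
      (at (p, q, u)) (p', q', u') = 2 * ((p $ i - p $ j) \<bullet> (p' $ i - p' $ j))"
proof -
  have nth: "((\<lambda>z :: ((real^3)^'v) \<times> (real^3) \<times> (real^3). fst z $ k) has_derivative (\<lambda>z. fst z $ k)) F" for k F
    by (rule bounded_linear_imp_has_derivative)
      (rule bounded_linear_compose[OF bounded_linear_vec_nth bounded_linear_fst])
  have "((\<lambda>z :: ((real^3)^'v) \<times> (real^3) \<times> (real^3). (fst z $ i - fst z $ j) \<bullet> (fst z $ i - fst z $ j))
      has_derivative (\<lambda>h. (fst (p, q, u) $ i - fst (p, q, u) $ j) \<bullet> (fst h $ i - fst h $ j)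
        + (fst h $ i - fst h $ j) \<bullet> (fst (p, q, u) $ i - fst (p, q, u) $ j))) (at (p, q, u))"
    by (intro has_derivative_inner has_derivative_diff nth)
  from frechet_derivative_at[OF this, symmetric] show ?thesis
    by (simp add: dist_norm power2_norm_eq_inner case_prod_unfold inner_commute)
qed

lemma squared_distance_derivative:
  fixes w u d v :: "'a::real_inner"
  assumes u: "u \<bullet> u \<noteq> 0" and t: "w \<bullet> u = t * (u \<bullet> u)"
  shows "w \<bullet> d + d \<bullet> w - (((w \<bullet> u) * (w \<bullet> v + d \<bullet> u) + (w \<bullet> v + d \<bullet> u) * (w \<bullet> u)) * (u \<bullet> u)
      - (w \<bullet> u) * (w \<bullet> u) * (u \<bullet> v + v \<bullet> u)) / ((u \<bullet> u) * (u \<bullet> u))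
    = 2 * ((w - t *\<^sub>R u) \<bullet> (d - t *\<^sub>R v))"
proof -
  have "(((w \<bullet> u) * (w \<bullet> v + d \<bullet> u) + (w \<bullet> v + d \<bullet> u) * (w \<bullet> u)) * (u \<bullet> u)
      - (w \<bullet> u) * (w \<bullet> u) * (u \<bullet> v + v \<bullet> u)) / ((u \<bullet> u) * (u \<bullet> u))
    = (2 * t * (w \<bullet> v + d \<bullet> u) - 2 * t * t * (u \<bullet> v)) * ((u \<bullet> u) * (u \<bullet> u)) / ((u \<bullet> u) * (u \<bullet> u))"
    unfolding t inner_commute[of v u] by (rule arg_cong2[where f = "(/)"]) (simp_all add: algebra_simps)
  also have "\<dots> = 2 * t * (w \<bullet> v + d \<bullet> u) - 2 * t * t * (u \<bullet> v)"
    using u by simp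
  finally show ?thesis
    by (simp add: inner_diff_left inner_diff_right inner_commute algebra_simps)
qed

text \<open>
  The squared distance changes at the rate at which \<open>x\<close> recedes, in the perpendicular direction, from
  the foot of the perpendicular, where the foot is carried along with velocity
  \<open>q' + height q u x *\<^sub>R u'\<close>.
\<close>

lemma frechet_derivative_point_line:
  fixes p p' :: "(real^3)^'v::finite"
  assumes u: "u \<noteq> 0"
  shows "frechet_derivative (\<lambda>(p :: (real^3)^'v, q, u). (infdist (p $ k) (line q u))\<^sup>2)
      (at (p, q, u)) (p', q', u')
    = 2 * (perp q u (p $ k) \<bullet> (p' $ k - q' - height q u (p $ k) *\<^sub>R u'))"
proof -
  let ?U = "{z :: ((real^3)^'v) \<times> (real^3) \<times> (real^3). snd (snd z) \<noteq> 0}"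
  let ?d = "\<lambda>z :: ((real^3)^'v) \<times> (real^3) \<times> (real^3). fst z $ k - fst (snd z)"
  let ?u = "\<lambda>z :: ((real^3)^'v) \<times> (real^3) \<times> (real^3). snd (snd z)"
  have nth: "((\<lambda>z :: ((real^3)^'v) \<times> (real^3) \<times> (real^3). fst z $ k) has_derivative (\<lambda>z. fst z $ k)) F" for F
    by (rule bounded_linear_imp_has_derivative)
      (rule bounded_linear_compose[OF bounded_linear_vec_nth bounded_linear_fst])
  have d: "(?d has_derivative ?d) F" for F
    by (intro has_derivative_diff nth has_derivative_fst has_derivative_snd has_derivative_ident)
  have du: "(?u has_derivative ?u) F" for F
    by (intro has_derivative_snd has_derivative_ident)
  let ?z = "(p, q, u)"
  let ?D = "\<lambda>h. 2 * (perp q u (p $ k) \<bullet> (?d h - height q u (p $ k) *\<^sub>R ?u h))"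
  have zu: "?u ?z \<bullet> ?u ?z \<noteq> 0" using u by simp
  have zt: "?d ?z \<bullet> ?u ?z = height q u (p $ k) * (?u ?z \<bullet> ?u ?z)" using u by (simp add: height_def)
  have "((\<lambda>z. ?d z \<bullet> ?d z - (?d z \<bullet> ?u z) * (?d z \<bullet> ?u z) / (?u z \<bullet> ?u z)) has_derivative ?D) (at ?z)"
  proof (rule has_derivative_eq_rhs[OF has_derivative_diff[OF has_derivative_inner[OF d d]
        has_derivative_divide'[OF has_derivative_mult[OF has_derivative_inner[OF d du]
          has_derivative_inner[OF d du]] has_derivative_inner[OF du du] zu]]], rule ext)
    fix h
    show "?d ?z \<bullet> ?d h + ?d h \<bullet> ?d ?z -
        (((?d ?z \<bullet> ?u ?z) * (?d ?z \<bullet> ?u h + ?d h \<bullet> ?u ?z) + (?d ?z \<bullet> ?u h + ?d h \<bullet> ?u ?z) * (?d ?z \<bullet> ?u ?z))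
            * (?u ?z \<bullet> ?u ?z)
          - (?d ?z \<bullet> ?u ?z) * (?d ?z \<bullet> ?u ?z) * (?u ?z \<bullet> ?u h + ?u h \<bullet> ?u ?z))
         / ((?u ?z \<bullet> ?u ?z) * (?u ?z \<bullet> ?u ?z)) = ?D h"
      unfolding squared_distance_derivative[OF zu zt] by (simp add: perp_def)
  qed
  moreover have "open ?U" by (intro open_Collect_neq continuous_intros)
  ultimately have "((\<lambda>z. (infdist (fst z $ k) (line (fst (snd z)) (snd (snd z))))\<^sup>2) has_derivative ?D) (at ?z)"
    by (rule has_derivative_transform_within_open) (use u in \<open>auto simp: infdist_line[unfolded power2_eq_square] power2_eq_square\<close>)
  from frechet_derivative_at[OF this, symmetric] show ?thesis
    by (simp add: case_prod_unfold)
qed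

lemma in_kernel_iff:
  fixes p p' :: "(real^3)^'v::finite"
  assumes u: "u \<noteq> 0" and E: "\<forall>e\<in>E. card e = 2"
  shows "in_kernel c E p q u p' q' u' \<longleftrightarrow>
    (\<forall>i. {i, c} \<in> E \<longrightarrow> perp q u (p $ i) \<bullet> (p' $ i - q' - height q u (p $ i) *\<^sub>R u') = 0) \<and>
    (\<forall>i j. i \<noteq> c \<longrightarrow> j \<noteq> c \<longrightarrow> {i, j} \<in> E \<longrightarrow> (p $ i - p $ j) \<bullet> (p' $ i - p' $ j) = 0)"
proof -
  have cc: "{c, c} \<notin> E" using E by force
  have dl: "frechet_derivative (\<lambda>(p :: (real^3)^'v, q, u). edge_fun c c j p (line q u)) (at (p, q, u)) (p', q', u')
      = 2 * (perp q u (p $ j) \<bullet> (p' $ j - q' - height q u (p $ j) *\<^sub>R u'))" for j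
    unfolding edge_fun_def using frechet_derivative_point_line[OF u, of j p q p' q' u'] by simp
  have dr: "frechet_derivative (\<lambda>(p :: (real^3)^'v, q, u). edge_fun c i c p (line q u)) (at (p, q, u)) (p', q', u')
      = 2 * (perp q u (p $ i) \<bullet> (p' $ i - q' - height q u (p $ i) *\<^sub>R u'))" if "i \<noteq> c" for i
    unfolding edge_fun_def using frechet_derivative_point_line[OF u, of i p q p' q' u'] that by simp
  have dp: "frechet_derivative (\<lambda>(p :: (real^3)^'v, q, u). edge_fun c i j p (line q u)) (at (p, q, u)) (p', q', u')
      = 2 * ((p $ i - p $ j) \<bullet> (p' $ i - p' $ j))" if "i \<noteq> c" "j \<noteq> c" for i j
    unfolding edge_fun_def using frechet_derivative_point_point[of i j p q u p' q' u'] that by simp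
  show ?thesis
  proof
    assume k: "in_kernel c E p q u p' q' u'"
    show "(\<forall>i. {i, c} \<in> E \<longrightarrow> perp q u (p $ i) \<bullet> (p' $ i - q' - height q u (p $ i) *\<^sub>R u') = 0) \<and>
      (\<forall>i j. i \<noteq> c \<longrightarrow> j \<noteq> c \<longrightarrow> {i, j} \<in> E \<longrightarrow> (p $ i - p $ j) \<bullet> (p' $ i - p' $ j) = 0)"
    proof (intro conjI allI impI)
      fix i assume "{i, c} \<in> E"
      then show "perp q u (p $ i) \<bullet> (p' $ i - q' - height q u (p $ i) *\<^sub>R u') = 0"
        using k dr[of i] cc unfolding in_kernel_def by (cases "i = c") auto
    next
      fix i j assume "i \<noteq> c" "j \<noteq> c" "{i, j} \<in> E"
      then show "(p $ i - p $ j) \<bullet> (p' $ i - p' $ j) = 0"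
        using k dp[of i j] unfolding in_kernel_def by auto
    qed
  next
    assume k: "(\<forall>i. {i, c} \<in> E \<longrightarrow> perp q u (p $ i) \<bullet> (p' $ i - q' - height q u (p $ i) *\<^sub>R u') = 0) \<and>
      (\<forall>i j. i \<noteq> c \<longrightarrow> j \<noteq> c \<longrightarrow> {i, j} \<in> E \<longrightarrow> (p $ i - p $ j) \<bullet> (p' $ i - p' $ j) = 0)"
    show "in_kernel c E p q u p' q' u'"
      unfolding in_kernel_def
    proof (intro allI impI)
      fix i j assume e: "{i, j} \<in> E"
      consider "i = c" | "i \<noteq> c" "j = c" | "i \<noteq> c" "j \<noteq> c" by blast
      then show "frechet_derivative (\<lambda>(p :: (real^3)^'v, q, u). edge_fun c i j p (line q u)) (at (p, q, u))
          (p', q', u') = 0"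
      proof cases
        case 1
        then have "{j, c} \<in> E" using e by (simp add: insert_commute)
        then show ?thesis unfolding 1 dl using k by simp
      next
        case 2
        show ?thesis unfolding 2(2) dr[OF 2(1)] using k e 2(2) by simp
      next
        case 3
        show ?thesis unfolding dp[OF 3] using k e 3 by simp
      qed
    qed
  qed
qed

section \<open>Motions that fix the line\<close>

unbundle cross3_syntax

lemma skew_symmetric_eq_cross:
  fixes A :: "real^3^3"
  assumes "transpose A = - A"
  obtains w where "\<And>x. A *v x = w \<times> x"
proof
  fix x
  have *: "A $ j $ i = - A $ i $ j" for i j
  proof -
    have "transpose A $ i $ j = (- A) $ i $ j" using assms by simp
    then show ?thesis by (simp add: transpose_def)
  qed
  have "A $ 1 $ 1 = 0" "A $ 2 $ 2 = 0" "A $ 3 $ 3 = 0" using *[of 1 1] *[of 2 2] *[of 3 3] by auto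
  with *[of 1 2] *[of 1 3] *[of 2 3]
  show "A *v x = vector [A $ 3 $ 2, A $ 1 $ 3, A $ 2 $ 1] \<times> x"
    by (simp add: vec_eq_iff forall_3 matrix_vector_mult_def sum_3 cross_components)
qed

lemma cross_eq_skew_symmetric:
  fixes w :: "real^3"
  obtains A :: "real^3^3" where "transpose A = - A" "\<And>x. A *v x = w \<times> x"
proof
  let ?A = "vector [vector [0, - w $ 3, w $ 2], vector [w $ 3, 0, - w $ 1], vector [- w $ 2, w $ 1, 0]] :: real^3^3"
  show "transpose ?A = - ?A"
    by (simp add: vec_eq_iff forall_3 transpose_def)
  show "?A *v x = w \<times> x" for x
    by (simp add: vec_eq_iff forall_3 matrix_vector_mult_def sum_3 cross_components)
qed

lemma induced_by_isometry_iff: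
  "induced_by_isometry Vp p q u p' q' u' \<longleftrightarrow>
    (\<exists>w b. (\<forall>i\<in>Vp. p' $ i = w \<times> (p $ i) + b) \<and> (\<exists>\<alpha>. q' = w \<times> q + b + \<alpha> *\<^sub>R u) \<and>
      (\<exists>\<beta>. u' = w \<times> u + \<beta> *\<^sub>R u))"
proof
  assume "induced_by_isometry Vp p q u p' q' u'"
  then obtain A :: "real^3^3" and b where A: "transpose A = - A"
    and r: "\<forall>i\<in>Vp. p' $ i = A *v (p $ i) + b" "\<exists>\<alpha>. q' = A *v q + b + \<alpha> *\<^sub>R u" "\<exists>\<beta>. u' = A *v u + \<beta> *\<^sub>R u"
    unfolding induced_by_isometry_def by blast
  obtain w where w: "\<And>x. A *v x = w \<times> x" by (rule skew_symmetric_eq_cross[OF A]) blast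
  show "\<exists>w b. (\<forall>i\<in>Vp. p' $ i = w \<times> (p $ i) + b) \<and> (\<exists>\<alpha>. q' = w \<times> q + b + \<alpha> *\<^sub>R u) \<and>
      (\<exists>\<beta>. u' = w \<times> u + \<beta> *\<^sub>R u)"
    using r unfolding w by blast
next
  assume "\<exists>w b. (\<forall>i\<in>Vp. p' $ i = w \<times> (p $ i) + b) \<and> (\<exists>\<alpha>. q' = w \<times> q + b + \<alpha> *\<^sub>R u) \<and>
      (\<exists>\<beta>. u' = w \<times> u + \<beta> *\<^sub>R u)"
  then obtain w b where r: "\<forall>i\<in>Vp. p' $ i = w \<times> (p $ i) + b" "\<exists>\<alpha>. q' = w \<times> q + b + \<alpha> *\<^sub>R u"
      "\<exists>\<beta>. u' = w \<times> u + \<beta> *\<^sub>R u" by blast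
  obtain A :: "real^3^3" where A: "transpose A = - A" "\<And>x. A *v x = w \<times> x"
    by (rule cross_eq_skew_symmetric[of w]) blast
  show "induced_by_isometry Vp p q u p' q' u'"
    unfolding induced_by_isometry_def using A(1) r unfolding A(2)[symmetric] by blast
qed

lemma point_eq_perp: "x = q + height q u x *\<^sub>R u + perp q u x"
  by (simp add: perp_def)

text \<open>
  The angular velocity of an isometry that fixes the line is parallel to \<open>u\<close>, so the isometry is a
  screw motion about the line.
\<close>

lemma induced_fixing_line_iff:
  assumes u: "u \<noteq> 0"
  shows "induced_by_isometry Vp p q u p' 0 0 \<longleftrightarrow>
    (\<exists>\<kappa> \<mu>. \<forall>i\<in>Vp. p' $ i = \<kappa> *\<^sub>R (perp q u (p $ i) \<times> u) + \<mu> *\<^sub>R u)"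
proof
  assume "induced_by_isometry Vp p q u p' 0 0"
  then obtain w b \<alpha> \<beta> where r: "\<And>i. i \<in> Vp \<Longrightarrow> p' $ i = w \<times> (p $ i) + b"
      "0 = w \<times> q + b + \<alpha> *\<^sub>R u" "0 = w \<times> u + \<beta> *\<^sub>R u"
    unfolding induced_by_isometry_iff by blast
  have "(w \<times> u + \<beta> *\<^sub>R u) \<bullet> u = \<beta> * (u \<bullet> u)" by (simp add: inner_add_left dot_cross_self)
  then have "\<beta> = 0" using r(3) u by simp
  then have wu: "w \<times> u = 0" using r(3) by simp
  have "(u \<bullet> u) *\<^sub>R w = (u \<bullet> w) *\<^sub>R u" using Lagrange[of u w u] wu by simp
  then have "(1 / (u \<bullet> u)) *\<^sub>R ((u \<bullet> u) *\<^sub>R w) = (1 / (u \<bullet> u)) *\<^sub>R ((u \<bullet> w) *\<^sub>R u)" by simp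
  then have w: "w = ((u \<bullet> w) / (u \<bullet> u)) *\<^sub>R u" using u by simp
  have "p' $ i = (- ((u \<bullet> w) / (u \<bullet> u))) *\<^sub>R (perp q u (p $ i) \<times> u) + (- \<alpha>) *\<^sub>R u" if "i \<in> Vp" for i
  proof -
    have "w \<times> (p $ i) = w \<times> q + w \<times> perp q u (p $ i)"
      by (subst point_eq_perp[of "p $ i" q u]) (simp add: cross_add_right cross_mult_right wu)
    moreover have "b = - (w \<times> q) - \<alpha> *\<^sub>R u" using r(2) by (simp add: eq_neg_iff_add_eq_0 algebra_simps)
    moreover have "w \<times> perp q u (p $ i) = (- ((u \<bullet> w) / (u \<bullet> u))) *\<^sub>R (perp q u (p $ i) \<times> u)"
      by (subst w) (simp add: cross_mult_left cross_skew[of u])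
    ultimately show ?thesis using r(1)[OF that] by simp
  qed
  then show "\<exists>\<kappa> \<mu>. \<forall>i\<in>Vp. p' $ i = \<kappa> *\<^sub>R (perp q u (p $ i) \<times> u) + \<mu> *\<^sub>R u" by blast
next
  assume "\<exists>\<kappa> \<mu>. \<forall>i\<in>Vp. p' $ i = \<kappa> *\<^sub>R (perp q u (p $ i) \<times> u) + \<mu> *\<^sub>R u"
  then obtain \<kappa> \<mu> where r: "\<And>i. i \<in> Vp \<Longrightarrow> p' $ i = \<kappa> *\<^sub>R (perp q u (p $ i) \<times> u) + \<mu> *\<^sub>R u" by blast
  let ?w = "(- \<kappa>) *\<^sub>R u" and ?b = "\<kappa> *\<^sub>R (u \<times> q) + \<mu> *\<^sub>R u"
  have "p' $ i = ?w \<times> (p $ i) + ?b" if "i \<in> Vp" for i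
  proof -
    have "u \<times> (p $ i) = u \<times> q + u \<times> perp q u (p $ i)"
      by (subst point_eq_perp[of "p $ i" q u]) (simp add: cross_add_right cross_mult_right)
    then have "\<kappa> *\<^sub>R (u \<times> (p $ i)) = \<kappa> *\<^sub>R (u \<times> q) + \<kappa> *\<^sub>R (u \<times> perp q u (p $ i))"
      by (simp add: scaleR_add_right)
    then show ?thesis using r[OF that] by (simp add: cross_mult_left cross_skew[of u "perp q u (p $ i)"])
  qed
  moreover have "0 = ?w \<times> q + ?b + (- \<mu>) *\<^sub>R u" by (simp add: cross_mult_left)
  moreover have "0 = ?w \<times> u + 0 *\<^sub>R u" by (simp add: cross_mult_left)
  ultimately show "induced_by_isometry Vp p q u p' 0 0"
    unfolding induced_by_isometry_iff by blast
qed

text \<open>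
  A vector orthogonal to \<open>h\<close> lies in the span of the orthogonal vectors \<open>h \<times> u\<close> and \<open>u\<close>.
\<close>

lemma orthogonal_decomposition:
  fixes h u v :: "real^3"
  assumes hu: "h \<bullet> u = 0" and hv: "h \<bullet> v = 0" and ne: "h \<noteq> 0" "u \<noteq> 0"
  shows "v = ((v \<bullet> (h \<times> u)) / ((h \<times> u) \<bullet> (h \<times> u))) *\<^sub>R (h \<times> u) + ((v \<bullet> u) / (u \<bullet> u)) *\<^sub>R u"
proof -
  let ?n = "h \<times> u"
  have nn: "?n \<bullet> ?n = (h \<bullet> h) * (u \<bullet> u)"
    using norm_cross_dot[of h u] hu by (simp add: power2_norm_eq_inner power_mult_distrib)
  have "v \<times> ?n = (v \<bullet> u) *\<^sub>R h" using Lagrange[of v h u] hv by (simp add: inner_commute)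
  then have "?n \<times> (v \<times> ?n) = (v \<bullet> u) *\<^sub>R (?n \<times> h)" by (simp add: cross_mult_right)
  also have "?n \<times> h = (h \<bullet> h) *\<^sub>R u"
    using Lagrange[of h h u] hu by (simp add: cross_skew[of ?n h])
  finally have "(?n \<bullet> ?n) *\<^sub>R v = (v \<bullet> ?n) *\<^sub>R ?n + ((v \<bullet> u) * (h \<bullet> h)) *\<^sub>R u"
    using Lagrange[of ?n v ?n] by (simp add: inner_commute algebra_simps)
  then have "(1 / (?n \<bullet> ?n)) *\<^sub>R ((?n \<bullet> ?n) *\<^sub>R v)
      = (1 / (?n \<bullet> ?n)) *\<^sub>R ((v \<bullet> ?n) *\<^sub>R ?n + ((v \<bullet> u) * (h \<bullet> h)) *\<^sub>R u)" by simp
  moreover have "?n \<bullet> ?n \<noteq> 0" unfolding nn using ne by simp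
  ultimately show ?thesis
    using ne by (simp add: scaleR_add_right nn)
qed

text \<open>
  \<open>twist\<close> and \<open>climb\<close> are the coefficients of the rotational and the translational unknowns in the
  equation of an edge; see the lemma \<open>edge_strain\<close>.
\<close>

definition twist :: "real^3 \<Rightarrow> real^3 \<Rightarrow> real^3 \<Rightarrow> real^3 \<Rightarrow> real" where
  "twist q u x y = u \<bullet> (perp q u x \<times> perp q u y)"

definition climb :: "real^3 \<Rightarrow> real^3 \<Rightarrow> real^3 \<Rightarrow> real^3 \<Rightarrow> real" where
  "climb q u x y = (u \<bullet> u) * (height q u x - height q u y)"

lemma edge_strain:
  assumes u: "u \<noteq> 0"
  shows "(x - y) \<bullet> ((a *\<^sub>R (perp q u x \<times> u) + b *\<^sub>R u) - (a' *\<^sub>R (perp q u y \<times> u) + b' *\<^sub>R u))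
    = twist q u x y * (a - a') + climb q u x y * (b - b')"
proof -
  let ?h = "perp q u x" and ?k = "perp q u y"
  have xy: "x - y = ?h - ?k + (height q u x - height q u y) *\<^sub>R u"
    by (simp add: perp_def algebra_simps)
  have 1: "?h \<bullet> (?k \<times> u) = twist q u x y" unfolding twist_def
    by (simp add: cross3_simps)
  have 2: "?k \<bullet> (?h \<times> u) = - twist q u x y" unfolding twist_def
    by (simp add: cross3_simps)
  show ?thesis
    unfolding xy using u
    by (simp add: inner_add_left inner_add_right inner_diff_left inner_diff_right dot_cross_self 1 2
        climb_def) (simp add: algebra_simps)
qed

lemma dir_rigid_scale:
  assumes "t \<noteq> 0"
  shows "dir_rigid V E f g (\<lambda>e. t * a e) (\<lambda>e. t * b e) \<longleftrightarrow> dir_rigid V E f g a b"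
proof -
  have "t * x * y + t * z * w = 0 \<longleftrightarrow> x * y + z * w = 0" for x y z w :: real
  proof -
    have "t * x * y + t * z * w = t * (x * y + z * w)" by (simp add: algebra_simps)
    then show ?thesis using assms by simp
  qed
  then show ?thesis unfolding dir_rigid_def by simp
qed

text \<open>
  Changing the representative \<open>(q, u)\<close> of a line multiplies the equations of all edges by one common
  factor, so it does not affect their solutions.
\<close>

lemma same_line:
  assumes u: "u \<noteq> 0" and w: "w \<noteq> 0" and eq: "line q u = line r w"
  obtains t where "t \<noteq> 0" "\<And>x y. twist r w x y = t * twist q u x y" "\<And>x y. climb r w x y = t * climb q u x y"
    "\<And>x. perp r w x = perp q u x"
proof -
  obtain s t where st: "t \<noteq> 0" "r = q + s *\<^sub>R u" "w = t *\<^sub>R u"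
    using eq line_eq_iff[OF u w] by blast
  have h: "height r w x = (height q u x - s) / t" for x
    unfolding height_def st(2,3) using st(1) u
    by (simp add: inner_diff_left inner_add_left field_simps)
  have p: "perp r w x = perp q u x" for x
    unfolding perp_def h unfolding st(2,3) using st(1) by (simp add: scaleR_diff_left)
  show thesis
  proof (rule that[OF st(1) _ _ p])
    show "twist r w x y = t * twist q u x y" for x y
      unfolding twist_def p by (simp add: st(3))
    show "climb r w x y = t * climb q u x y" for x y
      unfolding climb_def h using st(1) by (simp add: st(3) field_simps)
  qed
qed

section \<open>Rigidity as uniqueness for a slope system\<close>

text \<open>
  An arbitrary orientation of the edges, so that sets of two vertices can serve as the labels of a
  multigraph.
\<close>

definition tail :: "'v set \<Rightarrow> 'v" where "tail e = (SOME i. i \<in> e)"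
definition head :: "'v set \<Rightarrow> 'v" where "head e = (SOME j. e = {tail e, j})"

lemma tail_head:
  assumes "card e = 2"
  shows "{tail e, head e} = e" "tail e \<noteq> head e" "tail e \<in> e" "head e \<in> e"
proof -
  obtain x y where xy: "e = {x, y}" "x \<noteq> y" using assms by (meson card_2_iff)
  show te: "tail e \<in> e" unfolding tail_def by (rule someI[of _ x]) (simp add: xy)
  then have "tail e = x \<or> tail e = y" unfolding xy(1) by simp
  then have "\<exists>j. e = {tail e, j}" using xy(1) by (metis insert_commute)
  from someI_ex[OF this, folded head_def] show e: "{tail e, head e} = e" by (rule sym)
  show "tail e \<noteq> head e"
  proof
    assume eq: "tail e = head e"
    have "card e = card {tail e, head e}" unfolding e ..
    also have "\<dots> = 1" unfolding eq by simp
    finally show False using assms by simp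
  qed
  show "head e \<in> e" using insertI2[of "head e" "{head e}" "tail e"] unfolding e by simp
qed

definition point_edges :: "'v \<Rightarrow> 'v set set \<Rightarrow> 'v set set" where
  "point_edges c E = {e \<in> E. c \<notin> e}"

definition cone_edges :: "'v set \<Rightarrow> 'v \<Rightarrow> 'v set set \<Rightarrow> bool" where
  "cone_edges Vp c E \<longleftrightarrow> c \<notin> Vp \<and> (\<forall>e\<in>E. card e = 2 \<and> e \<subseteq> insert c Vp) \<and> (\<forall>i\<in>Vp. {i, c} \<in> E)"

lemma point_edges_ends:
  assumes "cone_edges Vp c E" "e \<in> point_edges c E"
  shows "tail e \<noteq> head e" "tail e \<in> Vp" "head e \<in> Vp"
proof -
  have e: "c \<notin> e" "card e = 2" "e \<subseteq> insert c Vp"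
    using assms by (auto simp: cone_edges_def point_edges_def)
  then have "e \<subseteq> Vp" by blast
  then show "tail e \<noteq> head e" "tail e \<in> Vp" "head e \<in> Vp" using tail_head[OF e(2)] by blast+
qed

lemma all_point_pairs_iff:
  assumes c: "\<forall>e\<in>E. card e = 2" and sym: "\<forall>i j. R i j \<longrightarrow> R j i"
  shows "(\<forall>i j. i \<noteq> c \<longrightarrow> j \<noteq> c \<longrightarrow> {i, j} \<in> E \<longrightarrow> R i j) \<longleftrightarrow> (\<forall>e\<in>point_edges c E. R (tail e) (head e))"
proof
  assume l: "\<forall>i j. i \<noteq> c \<longrightarrow> j \<noteq> c \<longrightarrow> {i, j} \<in> E \<longrightarrow> R i j"
  show "\<forall>e\<in>point_edges c E. R (tail e) (head e)"
  proof
    fix e assume "e \<in> point_edges c E"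
    then have e: "e \<in> E" "c \<notin> e" by (auto simp: point_edges_def)
    then have "card e = 2" using c by blast
    then have "tail e \<noteq> c" "head e \<noteq> c" "{tail e, head e} \<in> E" using tail_head[of e] e by auto
    then show "R (tail e) (head e)" using l by blast
  qed
next
  assume r: "\<forall>e\<in>point_edges c E. R (tail e) (head e)"
  show "\<forall>i j. i \<noteq> c \<longrightarrow> j \<noteq> c \<longrightarrow> {i, j} \<in> E \<longrightarrow> R i j"
  proof (intro allI impI)
    fix i j assume ij: "i \<noteq> c" "j \<noteq> c" "{i, j} \<in> E"
    let ?e = "{i, j}"
    have "R (tail ?e) (head ?e)" using r ij by (simp add: point_edges_def)
    moreover have "{tail ?e, head ?e} = ?e" by (rule tail_head(1)) (use c ij(3) in blast)
    ultimately show "R i j" using sym unfolding doubleton_eq_iff by metis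
  qed
qed

lemma in_kernel_cone_iff:
  fixes p p' :: "(real^3)^'v::finite"
  assumes u: "u \<noteq> 0" and E: "cone_edges Vp c E"
  shows "in_kernel c E p q u p' q' u' \<longleftrightarrow>
    (\<forall>i\<in>Vp. perp q u (p $ i) \<bullet> (p' $ i - q' - height q u (p $ i) *\<^sub>R u') = 0) \<and>
    (\<forall>e\<in>point_edges c E. (p $ tail e - p $ head e) \<bullet> (p' $ tail e - p' $ head e) = 0)"
proof -
  have c2: "\<forall>e\<in>E. card e = 2" using E by (simp add: cone_edges_def)
  have ic: "{i, c} \<in> E \<longleftrightarrow> i \<in> Vp" for i
  proof
    assume e: "{i, c} \<in> E"
    then have "card {i, c} = 2" "{i, c} \<subseteq> insert c Vp" using E unfolding cone_edges_def by blast+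
    then show "i \<in> Vp" by (cases "i = c") auto
  qed (use E in \<open>simp add: cone_edges_def\<close>)
  have "(p $ j - p $ i) \<bullet> (p' $ j - p' $ i) = (p $ i - p $ j) \<bullet> (p' $ i - p' $ j)" for i j
    by (simp add: inner_diff_left inner_diff_right)
  then have "\<forall>i j. (p $ i - p $ j) \<bullet> (p' $ i - p' $ j) = 0 \<longrightarrow> (p $ j - p $ i) \<bullet> (p' $ j - p' $ i) = 0"
    by simp
  note pairs = all_point_pairs_iff[OF c2 this, of c]
  show ?thesis unfolding in_kernel_iff[OF u c2] ic pairs by blast
qed

text \<open>
  From left to right, a solution \<open>\<alpha>\<close>, \<open>\<beta>\<close> defines a motion that fixes the line; if an isometry induces it,
  then \<open>\<alpha>\<close> and \<open>\<beta>\<close> are constant by \<open>induced_fixing_line_iff\<close>. From right to left, the isometry with angular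
  velocity \<open>w\<close> and translation \<open>b\<close> moves the line as the given motion does. The difference of the two
  motions fixes the line, preserves the distances to it, and thus has components \<open>\<alpha>\<close>, \<open>\<beta>\<close> that solve the
  system.
\<close>

lemma rigid_at_iff_dir_rigid:
  fixes p :: "(real^3)^'v::finite"
  assumes u: "u \<noteq> 0" and E: "cone_edges Vp c E" and V: "Vp \<noteq> {}"
    and off: "\<forall>i\<in>Vp. p $ i \<notin> line q u"
  shows "(\<forall>p' q' u'. in_kernel c E p q u p' q' u' \<longrightarrow> induced_by_isometry Vp p q u p' q' u') \<longleftrightarrow>
    dir_rigid Vp (point_edges c E) tail head (\<lambda>e. twist q u (p $ tail e) (p $ head e))
      (\<lambda>e. climb q u (p $ tail e) (p $ head e))"
    (is "?L \<longleftrightarrow> ?R")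
proof -
  let ?h = "\<lambda>i. perp q u (p $ i)"
  have hne: "?h i \<noteq> 0" if "i \<in> Vp" for i using off that perp_eq_0_iff[OF u] by blast
  have nne: "?h i \<times> u \<noteq> 0" if "i \<in> Vp" for i
    using norm_and_cross_eq_0[of "?h i" u] hne[OF that] u by auto
  note ends = point_edges_ends[OF E]
  show ?thesis
  proof
    assume L: ?L
    show ?R
      unfolding dir_rigid_def
    proof (intro allI impI)
      fix \<alpha> \<beta> :: "'v \<Rightarrow> real"
      assume k: "\<forall>e\<in>point_edges c E. twist q u (p $ tail e) (p $ head e) * (\<alpha> (tail e) - \<alpha> (head e)) +
        climb q u (p $ tail e) (p $ head e) * (\<beta> (tail e) - \<beta> (head e)) = 0"
      define p' :: "(real^3)^'v" where "p' = (\<chi> i. \<alpha> i *\<^sub>R (?h i \<times> u) + \<beta> i *\<^sub>R u)"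
      have "in_kernel c E p q u p' 0 0"
        unfolding in_kernel_cone_iff[OF u E]
      proof (intro conjI ballI)
        fix i assume "i \<in> Vp"
        show "?h i \<bullet> (p' $ i - 0 - height q u (p $ i) *\<^sub>R 0) = 0"
          using u by (simp add: p'_def inner_add_right dot_cross_self)
      next
        fix e assume "e \<in> point_edges c E"
        then show "(p $ tail e - p $ head e) \<bullet> (p' $ tail e - p' $ head e) = 0"
          using k by (simp add: p'_def edge_strain[OF u])
      qed
      then have "induced_by_isometry Vp p q u p' 0 0" using L by blast
      then obtain \<kappa> \<mu> where km: "\<And>i. i \<in> Vp \<Longrightarrow> p' $ i = \<kappa> *\<^sub>R (?h i \<times> u) + \<mu> *\<^sub>R u"
        unfolding induced_fixing_line_iff[OF u] by blast
      have "\<alpha> i = \<kappa> \<and> \<beta> i = \<mu>" if i: "i \<in> Vp" for i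
      proof -
        have eq: "\<alpha> i *\<^sub>R (?h i \<times> u) + \<beta> i *\<^sub>R u = \<kappa> *\<^sub>R (?h i \<times> u) + \<mu> *\<^sub>R u"
          using km[OF i] by (simp add: p'_def)
        have "\<beta> i * (u \<bullet> u) = \<mu> * (u \<bullet> u)"
          using arg_cong[OF eq, of "\<lambda>x. x \<bullet> u"] by (simp add: inner_add_left dot_cross_self)
        then have b: "\<beta> i = \<mu>" using u by simp
        then show ?thesis using eq nne[OF i] by simp
      qed
      then show "\<forall>i\<in>Vp. \<forall>j\<in>Vp. \<alpha> i = \<alpha> j \<and> \<beta> i = \<beta> j" by simp
    qed
  next
    assume R: ?R
    show ?L
    proof (intro allI impI)
      fix p' q' u' assume k: "in_kernel c E p q u p' q' u'"
      \<comment> \<open>\<open>w\<close> turns \<open>u\<close> in the direction of \<open>u'\<close>, up to a multiple of \<open>u\<close>, which does not move the line\<close>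
      define w where "w = (1 / (u \<bullet> u)) *\<^sub>R (u \<times> u')"
      define \<beta>0 where "\<beta>0 = (u \<bullet> u') / (u \<bullet> u)"
      define b where "b = q' - w \<times> q"
      have u': "u' = w \<times> u + \<beta>0 *\<^sub>R u"
      proof -
        have "(u \<times> u') \<times> u = (u \<bullet> u) *\<^sub>R u' - (u \<bullet> u') *\<^sub>R u"
          using Lagrange[of u u u'] by (simp add: cross_skew[of "u \<times> u'" u])
        then show ?thesis using u by (simp add: w_def \<beta>0_def cross_mult_left scaleR_diff_right)
      qed
      define p2 where "p2 i = p' $ i - (w \<times> (p $ i) + b)" for i
      have rel: "p' $ i - q' - height q u (p $ i) *\<^sub>R u'
          = p2 i + (w \<times> ?h i - (height q u (p $ i) * \<beta>0) *\<^sub>R u)" for i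
      proof -
        have "w \<times> (p $ i) = w \<times> q + height q u (p $ i) *\<^sub>R (w \<times> u) + w \<times> ?h i"
          by (subst point_eq_perp[of "p $ i" q u]) (simp add: cross_add_right cross_mult_right)
        then show ?thesis unfolding p2_def b_def by (subst u') (simp add: algebra_simps)
      qed
      have orth: "?h i \<bullet> p2 i = 0" if "i \<in> Vp" for i
      proof -
        have "?h i \<bullet> (p' $ i - q' - height q u (p $ i) *\<^sub>R u') = 0"
          using k that unfolding in_kernel_cone_iff[OF u E] by blast
        then show ?thesis unfolding rel using u
          by (simp add: inner_add_right inner_diff_right dot_cross_self)
      qed
      define \<alpha> where "\<alpha> i = (p2 i \<bullet> (?h i \<times> u)) / ((?h i \<times> u) \<bullet> (?h i \<times> u))" for i
      define \<beta> where "\<beta> i = (p2 i \<bullet> u) / (u \<bullet> u)" for i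
      have dec: "p2 i = \<alpha> i *\<^sub>R (?h i \<times> u) + \<beta> i *\<^sub>R u" if "i \<in> Vp" for i
        unfolding \<alpha>_def \<beta>_def
        by (rule orthogonal_decomposition) (use u orth[OF that] hne[OF that] in auto)
      have eq: "twist q u (p $ tail e) (p $ head e) * (\<alpha> (tail e) - \<alpha> (head e)) +
        climb q u (p $ tail e) (p $ head e) * (\<beta> (tail e) - \<beta> (head e)) = 0"
        if e: "e \<in> point_edges c E" for e
      proof -
        let ?d = "p $ tail e - p $ head e"
        have "?d \<bullet> (p' $ tail e - p' $ head e) = 0"
          using k e unfolding in_kernel_cone_iff[OF u E] by blast
        moreover have "p' $ tail e - p' $ head e = (p2 (tail e) - p2 (head e)) + w \<times> ?d"
          by (simp add: p2_def Cross3.right_diff_distrib)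
        ultimately have "?d \<bullet> (p2 (tail e) - p2 (head e)) = 0"
          by (simp add: inner_add_right dot_cross_self)
        then show ?thesis
          unfolding dec[OF ends(2)[OF e]] dec[OF ends(3)[OF e]] edge_strain[OF u] .
      qed
      obtain o' where o': "o' \<in> Vp" using V by blast
      have cst: "\<alpha> i = \<alpha> o'" "\<beta> i = \<beta> o'" if "i \<in> Vp" for i
        using dir_rigidD[OF R that o', of \<alpha> \<beta>] eq by blast+
      let ?p2 = "(\<chi> i. p2 i) :: (real^3)^'v"
      have "induced_by_isometry Vp p q u ?p2 0 0"
        unfolding induced_fixing_line_iff[OF u] using dec cst by (intro exI[of _ "\<alpha> o'"] exI[of _ "\<beta> o'"]) simp
      then obtain w2 b2 \<alpha>2 \<beta>2 where i2: "\<And>i. i \<in> Vp \<Longrightarrow> p2 i = w2 \<times> (p $ i) + b2"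
        "0 = w2 \<times> q + b2 + \<alpha>2 *\<^sub>R u" "0 = w2 \<times> u + \<beta>2 *\<^sub>R u"
        unfolding induced_by_isometry_iff by auto
      have "p' $ i = (w + w2) \<times> (p $ i) + (b + b2)" if "i \<in> Vp" for i
        using i2(1)[OF that] by (simp add: p2_def cross_add_left algebra_simps)
      moreover have "q' = (w + w2) \<times> q + (b + b2) + \<alpha>2 *\<^sub>R u"
      proof -
        have "(w + w2) \<times> q + (b + b2) + \<alpha>2 *\<^sub>R u = q' + (w2 \<times> q + b2 + \<alpha>2 *\<^sub>R u)"
          by (simp add: b_def cross_add_left algebra_simps)
        then show ?thesis unfolding i2(2)[symmetric] by simp
      qed
      moreover have "u' = (w + w2) \<times> u + (\<beta>0 + \<beta>2) *\<^sub>R u"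
      proof -
        have "(w + w2) \<times> u + (\<beta>0 + \<beta>2) *\<^sub>R u = (w \<times> u + \<beta>0 *\<^sub>R u) + (w2 \<times> u + \<beta>2 *\<^sub>R u)"
          by (simp add: cross_add_left algebra_simps)
        then show ?thesis unfolding i2(3)[symmetric] u'[symmetric] by simp
      qed
      ultimately show "induced_by_isometry Vp p q u p' q' u'"
        unfolding induced_by_isometry_iff by blast
    qed
  qed
qed

lemma infinitesimally_rigid_iff_dir_rigid:
  fixes p :: "(real^3)^'v::finite"
  assumes u: "u \<noteq> 0" and E: "cone_edges Vp c E" and V: "Vp \<noteq> {}"
    and off: "\<forall>i\<in>Vp. p $ i \<notin> line q u"
  shows "infinitesimally_rigid Vp c E p (line q u) \<longleftrightarrow>
    dir_rigid Vp (point_edges c E) tail head (\<lambda>e. twist q u (p $ tail e) (p $ head e))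
      (\<lambda>e. climb q u (p $ tail e) (p $ head e))"
    (is "_ \<longleftrightarrow> ?R q u")
proof
  assume "infinitesimally_rigid Vp c E p (line q u)"
  then have "\<forall>p' q' u'. in_kernel c E p q u p' q' u' \<longrightarrow> induced_by_isometry Vp p q u p' q' u'"
    using u unfolding infinitesimally_rigid_def by blast
  then show "?R q u" by (rule iffD1[OF rigid_at_iff_dir_rigid[OF u E V off]])
next
  assume R: "?R q u"
  show "infinitesimally_rigid Vp c E p (line q u)"
    unfolding infinitesimally_rigid_def
  proof (intro allI impI, elim conjE)
    fix r w p' q' u'
    assume w: "w \<noteq> 0" and eq: "line q u = line r w" and k: "in_kernel c E p r w p' q' u'"
    obtain t where t: "t \<noteq> 0" "\<And>x y. twist r w x y = t * twist q u x y" "\<And>x y. climb r w x y = t * climb q u x y"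
      by (rule same_line[OF u w eq]) blast
    have "?R r w" unfolding t(2,3) by (rule iffD2[OF dir_rigid_scale[OF t(1)] R])
    then have "\<forall>p' q' u'. in_kernel c E p r w p' q' u' \<longrightarrow> induced_by_isometry Vp p r w p' q' u'"
      by (rule iffD2[OF rigid_at_iff_dir_rigid[OF w E V off[unfolded eq]]])
    then show "induced_by_isometry Vp p r w p' q' u'" using k by blast
  qed
qed

text \<open>
  The velocity of the point \<open>i\<close> gets the radial component \<open>perp q u (p $ i)\<close>. The resulting violations
  of the equations between points are compensated by a suitable choice of \<open>\<alpha>\<close> and \<open>\<beta>\<close>, which exists by
  independence. No isometry that fixes the line has a radial component.
\<close>

lemma not_rigid_without_line_edge:
  fixes p :: "(real^3)^'v::finite"
  assumes u: "u \<noteq> 0" and E: "cone_edges Vp c E" and i: "i \<in> Vp" "p $ i \<notin> line q u"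
    and ind: "dir_independent (point_edges c E) tail head (\<lambda>e. twist q u (p $ tail e) (p $ head e))
      (\<lambda>e. climb q u (p $ tail e) (p $ head e))"
  shows "\<not> infinitesimally_rigid Vp c (E - {{i, c}}) p (line q u)"
proof
  assume rig: "infinitesimally_rigid Vp c (E - {{i, c}}) p (line q u)"
  let ?h = "\<lambda>j. perp q u (p $ j)"
  define r where "r j = (if j = i then ?h i else 0)" for j
  obtain \<alpha> \<beta> where sol: "\<forall>e\<in>point_edges c E.
      twist q u (p $ tail e) (p $ head e) * (\<alpha> (tail e) - \<alpha> (head e)) +
      climb q u (p $ tail e) (p $ head e) * (\<beta> (tail e) - \<beta> (head e))
      = - ((p $ tail e - p $ head e) \<bullet> (r (tail e) - r (head e)))"
    using dir_independent_solvable[OF ind finite, of "\<lambda>e. - ((p $ tail e - p $ head e) \<bullet> (r (tail e) - r (head e)))"]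
    by blast
  define p' :: "(real^3)^'v" where "p' = (\<chi> j. (\<alpha> j *\<^sub>R (?h j \<times> u) + \<beta> j *\<^sub>R u) + r j)"
  have c2: "\<forall>e\<in>E - {{i, c}}. card e = 2" using E by (simp add: cone_edges_def)
  have sub: "point_edges c (E - {{i, c}}) = point_edges c E" by (auto simp: point_edges_def)
  have "(p $ j - p $ k) \<bullet> (p' $ j - p' $ k) = (p $ k - p $ j) \<bullet> (p' $ k - p' $ j)" for j k
    by (simp add: inner_diff_left inner_diff_right)
  then have "\<forall>j k. (p $ j - p $ k) \<bullet> (p' $ j - p' $ k) = 0 \<longrightarrow> (p $ k - p $ j) \<bullet> (p' $ k - p' $ j) = 0"
    by simp
  note pairs = all_point_pairs_iff[OF c2 this, of c, unfolded sub]
  have "(p $ tail e - p $ head e) \<bullet> (p' $ tail e - p' $ head e) = 0" if e: "e \<in> point_edges c E" for e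
  proof -
    have "p' $ tail e - p' $ head e = ((\<alpha> (tail e) *\<^sub>R (?h (tail e) \<times> u) + \<beta> (tail e) *\<^sub>R u)
        - (\<alpha> (head e) *\<^sub>R (?h (head e) \<times> u) + \<beta> (head e) *\<^sub>R u)) + (r (tail e) - r (head e))"
      by (simp add: p'_def)
    then show ?thesis
      using sol e by (simp only: inner_add_right edge_strain[OF u])
  qed
  then have "\<forall>j k. j \<noteq> c \<longrightarrow> k \<noteq> c \<longrightarrow> {j, k} \<in> E - {{i, c}} \<longrightarrow> (p $ j - p $ k) \<bullet> (p' $ j - p' $ k) = 0"
    unfolding pairs by blast
  moreover have "?h j \<bullet> (p' $ j - 0 - height q u (p $ j) *\<^sub>R 0) = 0" if "{j, c} \<in> E - {{i, c}}" for j
  proof -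
    have "j \<noteq> i" using that by blast
    then show ?thesis using u by (simp add: p'_def r_def inner_add_right dot_cross_self)
  qed
  ultimately have "in_kernel c (E - {{i, c}}) p q u p' 0 0"
    unfolding in_kernel_iff[OF u c2] by blast
  then have "induced_by_isometry Vp p q u p' 0 0"
    using rig u unfolding infinitesimally_rigid_def by blast
  then obtain \<kappa> \<mu> where "p' $ i = \<kappa> *\<^sub>R (?h i \<times> u) + \<mu> *\<^sub>R u"
    unfolding induced_fixing_line_iff[OF u] using i(1) by blast
  from arg_cong[OF this, of "\<lambda>x. ?h i \<bullet> x"] have "?h i \<bullet> ?h i = 0"
    using u by (simp add: p'_def r_def inner_add_right dot_cross_self)
  then show False using i(2) perp_eq_0_iff[OF u] by simp
qed

section \<open>Maximal independence and minimal rigidity\<close>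

lemma cone_graph_cone_edges:
  assumes "cone_graph V E c"
  shows "cone_edges (V - {c}) c E"
  using assms by (auto simp: cone_graph_def simple_graph_def cone_edges_def insert_commute)

lemma spanned_point_edges:
  assumes E: "cone_edges Vp c E" and X: "X \<subseteq> Vp"
  shows "spanned (point_edges c E) tail head X = {e \<in> E. e \<subseteq> X}"
proof (intro equalityI subsetI)
  fix e assume "e \<in> spanned (point_edges c E) tail head X"
  then have e: "e \<in> E" "{tail e, head e} \<subseteq> X" by (auto simp: spanned_def point_edges_def)
  moreover have "{tail e, head e} = e" by (rule tail_head(1)) (use e(1) E in \<open>simp add: cone_edges_def\<close>)
  ultimately show "e \<in> {e \<in> E. e \<subseteq> X}" by simp
next
  fix e assume "e \<in> {e \<in> E. e \<subseteq> X}"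
  then have e: "e \<in> E" "e \<subseteq> X" by auto
  have "card e = 2" using e(1) E by (simp add: cone_edges_def)
  then have "tail e \<in> X" "head e \<in> X" using tail_head(3,4) e(2) by blast+
  moreover have "c \<notin> e" using e(2) X E by (auto simp: cone_edges_def)
  ultimately show "e \<in> spanned (point_edges c E) tail head X"
    using e(1) by (simp add: spanned_def point_edges_def)
qed

lemma card_cone_edges_within:
  assumes E: "cone_edges Vp c E" and X: "X \<subseteq> Vp" "finite X"
  shows "card {e \<in> E. e \<subseteq> insert c X} = card X + card {e \<in> E. e \<subseteq> X}"
proof -
  have fin: "finite {e \<in> E. e \<subseteq> X}" using X(2) by (auto intro: finite_subset[of _ "Pow X"])
  have "{e \<in> E. e \<subseteq> insert c X} = (\<lambda>i. {i, c}) ` X \<union> {e \<in> E. e \<subseteq> X}"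
  proof (intro equalityI subsetI)
    fix e assume e: "e \<in> {e \<in> E. e \<subseteq> insert c X}"
    then have "card e = 2" using E by (simp add: cone_edges_def)
    then obtain x y where xy: "e = {x, y}" "x \<noteq> y" by (meson card_2_iff)
    show "e \<in> (\<lambda>i. {i, c}) ` X \<union> {e \<in> E. e \<subseteq> X}"
      using e xy by (cases "x = c"; cases "y = c") auto
  next
    fix e assume "e \<in> (\<lambda>i. {i, c}) ` X \<union> {e \<in> E. e \<subseteq> X}"
    then show "e \<in> {e \<in> E. e \<subseteq> insert c X}" using E X by (auto simp: cone_edges_def)
  qed
  moreover have "(\<lambda>i. {i, c}) ` X \<inter> {e \<in> E. e \<subseteq> X} = {}"
    using E X by (auto simp: cone_edges_def)
  moreover have "inj_on (\<lambda>i. {i, c}) X" by (auto simp: inj_on_def doubleton_eq_iff)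
  ultimately show ?thesis using X(2) fin by (simp add: card_Un_disjoint card_image)
qed

lemma card_edges_on_three_points:
  assumes X: "card X = 3" and F: "\<And>e. e \<in> F \<Longrightarrow> card e = 2 \<and> e \<subseteq> X"
  shows "card F \<le> 3"
proof -
  have fin: "finite X" using X card.infinite by fastforce
  have "F \<subseteq> {e. e \<subseteq> X \<and> card e = 2}" using F by blast
  then have "card F \<le> card {e. e \<subseteq> X \<and> card e = 2}"
    by (intro card_mono) (use fin in auto)
  also have "\<dots> = 3 choose 2" using n_subsets[OF fin, of 2] X by simp
  finally show ?thesis by (simp add: choose_two)
qed

text \<open>
  Nonempty subgraphs with the line are compared with all edges on \<open>insert c X\<close>, of which \<open>|X|\<close> go to the
  line. For subgraphs on points only, the cases \<open>|X| = 2\<close> (only the excluded single edge), \<open>|X| = 3\<close>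
  (at most three edges, by simplicity) and \<open>|X| \<ge> 4\<close> are distinguished.
\<close>

lemma tight_iff_maximally_independent:
  fixes E :: "'v::finite set set"
  assumes E: "cone_edges Vp c E"
  shows "maximally_independent Vp {c} E \<longleftrightarrow> tight Vp (point_edges c E) tail head"
proof -
  have cV: "c \<notin> Vp" and e2: "\<And>e. e \<in> E \<Longrightarrow> card e = 2" and eV: "\<And>e. e \<in> E \<Longrightarrow> e \<subseteq> insert c Vp"
    using E by (auto simp: cone_edges_def)
  have Eall: "{e \<in> E. e \<subseteq> insert c Vp} = E" using eV by blast
  have cE: "card E = card Vp + card {e \<in> E. e \<subseteq> Vp}"
    using card_cone_edges_within[OF E order_refl finite] unfolding Eall .
  have Pall: "point_edges c E = {e \<in> E. e \<subseteq> Vp}"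
    using eV cV by (auto simp: point_edges_def)
  have tight_iff: "tight Vp (point_edges c E) tail head \<longleftrightarrow> card {e \<in> E. e \<subseteq> Vp} + 2 = 2 * card Vp \<and>
      (\<forall>X\<subseteq>Vp. X \<noteq> {} \<longrightarrow> card {e \<in> E. e \<subseteq> X} + 2 \<le> 2 * card X)"
    unfolding tight_def using point_edges_ends[OF E] spanned_point_edges[OF E] Pall by auto
  show ?thesis
  proof
    assume m: "maximally_independent Vp {c} E"
    have sub: "freedom Xp Xl F \<ge> 6" if "point_line_subgraph Xp Xl F Vp {c} E" "F \<noteq> {}" "Xl \<noteq> {}" for Xp Xl F
      using m that unfolding maximally_independent_def by blast
    have "card {e \<in> E. e \<subseteq> Vp} + 2 = 2 * card Vp"
      using m cE by (simp add: maximally_independent_def freedom_def)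
    moreover have "card {e \<in> E. e \<subseteq> X} + 2 \<le> 2 * card X" if X: "X \<subseteq> Vp" "X \<noteq> {}" for X
    proof -
      let ?F = "{e \<in> E. e \<subseteq> insert c X}"
      obtain x where "x \<in> X" using X(2) by blast
      then have "{x, c} \<in> ?F" using E X(1) by (auto simp: cone_edges_def)
      moreover have "point_line_subgraph X {c} ?F Vp {c} E"
        using X(1) by (auto simp: point_line_subgraph_def)
      ultimately have "freedom X {c} ?F \<ge> 6" by (intro sub) auto
      then show ?thesis
        unfolding freedom_def card_cone_edges_within[OF E X(1) finite] by simp
    qed
    ultimately show "tight Vp (point_edges c E) tail head" unfolding tight_iff by blast
  next
    assume "tight Vp (point_edges c E) tail head"
    then have t: "card {e \<in> E. e \<subseteq> Vp} + 2 = 2 * card Vp"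
      "\<And>X. X \<subseteq> Vp \<Longrightarrow> X \<noteq> {} \<Longrightarrow> card {e \<in> E. e \<subseteq> X} + 2 \<le> 2 * card X"
      unfolding tight_iff by auto
    have "point_line_graph Vp {c} E"
      unfolding point_line_graph_def simple_graph_def
    proof (intro conjI ballI)
      show "\<not> e \<subseteq> {c}" if "e \<in> E" for e
        using card_mono[of "{c}" e] e2[OF that] by auto
    qed (use e2 eV cV in auto)
    moreover have "freedom Vp {c} E = 6" using t(1) cE by (simp add: freedom_def)
    moreover have "freedom Xp Xl F \<ge> 6"
      if s: "point_line_subgraph Xp Xl F Vp {c} E" and F: "F \<noteq> {}"
        and ex: "\<not> (\<exists>e. F = {e} \<and> Xp = e \<and> Xl = {})" for Xp Xl F
    proof -
      have X: "Xp \<subseteq> Vp" and Xl: "Xl = {} \<or> Xl = {c}" and FE: "F \<subseteq> E" and FX: "\<And>e. e \<in> F \<Longrightarrow> e \<subseteq> Xp \<union> Xl"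
        using s unfolding point_line_subgraph_def by blast+
      obtain e0 where e0: "e0 \<in> F" using F by blast
      have Fe: "card e = 2" if "e \<in> F" for e using FE e2 that by blast
      show ?thesis using Xl
      proof
        assume l: "Xl = {c}"
        have "Xp \<noteq> {}"
        proof
          assume "Xp = {}"
          then have "card e0 \<le> card {c}" using FX[OF e0] l by (intro card_mono) auto
          then show False using Fe[OF e0] by simp
        qed
        from t(2)[OF X this] have "card Xp + card {e \<in> E. e \<subseteq> Xp} + 2 \<le> 3 * card Xp" by simp
        moreover have "card F \<le> card {e \<in> E. e \<subseteq> insert c Xp}"
          by (intro card_mono) (use FE FX l in auto)
        ultimately show ?thesis
          unfolding freedom_def l card_cone_edges_within[OF E X finite] by simp
      next
        assume l: "Xl = {}"
        have FX': "e \<subseteq> Xp" if "e \<in> F" for e using FX[OF that] l by simp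
        have ge2: "card Xp \<ge> 2" using card_mono[OF finite FX'[OF e0]] Fe[OF e0] by simp
        have "card Xp \<noteq> 2"
        proof
          assume c2: "card Xp = 2"
          have "e = Xp" if "e \<in> F" for e
            by (rule card_subset_eq[OF finite FX'[OF that]]) (simp add: Fe[OF that] c2)
          then have "F = {Xp}" using F by blast
          then show False using ex l by blast
        qed
        then consider "card Xp = 3" | "card Xp \<ge> 4" using ge2 by linarith
        then show ?thesis
        proof cases
          case 1
          then have "card F \<le> 3" using card_edges_on_three_points[of Xp F] Fe FX' by blast
          then show ?thesis using 1 l by (simp add: freedom_def)
        next
          case 2
          then have "Xp \<noteq> {}" by auto
          from t(2)[OF X this] have "card {e \<in> E. e \<subseteq> Xp} + 2 \<le> 2 * card Xp" .
          moreover have "card F \<le> card {e \<in> E. e \<subseteq> Xp}"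
            by (intro card_mono) (use FE FX' in auto)
          ultimately show ?thesis using 2 l by (simp add: freedom_def)
        qed
      qed
    qed
    ultimately show "maximally_independent Vp {c} E"
      unfolding maximally_independent_def by blast
  qed
qed

text \<open>
  No point lies on the line, because the squared distance of such a point to the line has derivative
  zero, so that its edge to the line could be removed without losing rigidity. Hence rigidity translates
  into uniqueness for the slope system, also after the removal of an edge between points.
\<close>

lemma tight_if_minimally_infinitesimally_rigid:
  fixes p :: "(real^3)^'v::finite"
  assumes E: "cone_edges Vp c E" and V: "Vp \<noteq> {}" and l: "l \<in> lines"
    and m: "minimally_infinitesimally_rigid Vp c E p l"
  shows "tight Vp (point_edges c E) tail head"
proof -
  obtain q u where u: "u \<noteq> 0" and lqu: "l = line q u" using l unfolding lines_def by blast
  have rig: "infinitesimally_rigid Vp c E p (line q u)"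
    and min: "\<And>e. e \<in> E \<Longrightarrow> \<not> infinitesimally_rigid Vp c (E - {e}) p (line q u)"
    using m unfolding minimally_infinitesimally_rigid_def lqu by blast+
  have c2: "\<forall>e\<in>E. card e = 2" using E by (simp add: cone_edges_def)
  have off: "\<forall>i\<in>Vp. p $ i \<notin> line q u"
  proof (intro ballI notI)
    fix i assume i: "i \<in> Vp" and on: "p $ i \<in> line q u"
    have "infinitesimally_rigid Vp c (E - {{i, c}}) p (line q u)"
      unfolding infinitesimally_rigid_def
    proof (intro allI impI, elim conjE)
      fix r w p' q' u'
      assume w: "w \<noteq> 0" and eq: "line q u = line r w" and k: "in_kernel c (E - {{i, c}}) p r w p' q' u'"
      have c2': "\<forall>e\<in>E - {{i, c}}. card e = 2" using c2 by blast
      have ic: "i \<noteq> c" using i E by (auto simp: cone_edges_def)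
      have "perp r w (p $ i) = 0" using on perp_eq_0_iff[OF w] unfolding eq by blast
      then have "in_kernel c E p r w p' q' u'"
        using k ic unfolding in_kernel_iff[OF w c2] in_kernel_iff[OF w c2']
        by (auto simp: doubleton_eq_iff)
      then show "induced_by_isometry Vp p r w p' q' u'"
        using rig w eq unfolding infinitesimally_rigid_def by blast
    qed
    moreover have "{i, c} \<in> E" using i E by (simp add: cone_edges_def)
    ultimately show False using min by blast
  qed
  show ?thesis
  proof (rule tight_if_minimally_rigid)
    show "dir_rigid Vp (point_edges c E) tail head (\<lambda>e. twist q u (p $ tail e) (p $ head e))
        (\<lambda>e. climb q u (p $ tail e) (p $ head e))"
      by (rule iffD1[OF infinitesimally_rigid_iff_dir_rigid[OF u E V off] rig])
    show "\<not> dir_rigid Vp (point_edges c E - {e}) tail head (\<lambda>e. twist q u (p $ tail e) (p $ head e))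
        (\<lambda>e. climb q u (p $ tail e) (p $ head e))" if e: "e \<in> point_edges c E" for e
    proof -
      have eE: "e \<in> E" "c \<notin> e" using e by (auto simp: point_edges_def)
      have E': "cone_edges Vp c (E - {e})" using E eE by (auto simp: cone_edges_def)
      have "point_edges c (E - {e}) = point_edges c E - {e}" by (auto simp: point_edges_def)
      then show ?thesis
        using infinitesimally_rigid_iff_dir_rigid[OF u E' V off] min[OF eE(1)] by simp
    qed
  qed (use point_edges_ends[OF E] V in auto)
qed

lemma minimally_infinitesimally_rigid_if_tight:
  fixes E :: "'v::finite set set"
  assumes E: "cone_edges Vp c E" and V: "Vp \<noteq> {}"
    and t: "tight Vp (point_edges c E) tail head"
  shows "\<exists>(p :: (real^3)^'v) l. l \<in> lines \<and> minimally_infinitesimally_rigid Vp c E p l"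
proof -
  let ?P = "point_edges c E"
  note td = tightD[OF t]
  have c2: "card e = 2" if "e \<in> E" for e using E that by (simp add: cone_edges_def)
  have "inj_on (\<lambda>e. {tail e, head e}) ?P"
    by (rule inj_onI) (use tail_head(1) c2 in \<open>auto simp: point_edges_def\<close>)
  then obtain X0 Y0 Z s0 where "realises Vp ?P ?P tail head X0 Y0 Z s0"
    using tight_realisable[OF t order_refl] by blast
  then obtain X Y s where r: "realises Vp ?P ?P tail head X Y Z s" and gp: "general_position Vp X Y"
    by (rule realises_general_position) (use td in auto)
  have rs: "slope_rigid Vp ?P tail head s" and Z: "inj_on Z Vp"
    and geo: "\<And>e. e \<in> ?P \<Longrightarrow> s e * (Z (tail e) - Z (head e)) = det2 X Y (tail e) (head e)"
    using r unfolding realises_def by blast+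
  define p :: "(real^3)^'v" where "p = (\<chi> i. vector [X i, Y i, Z i])"
  define u :: "real^3" where "u = axis 3 1"
  have u: "u \<noteq> 0" by (simp add: u_def axis_eq_0_iff)
  have ui: "x \<bullet> u = x $ 3" for x by (simp add: u_def inner_axis)
  have h: "height 0 u (p $ i) = Z i" for i by (simp add: height_def ui p_def) (simp add: u_def)
  have pe: "perp 0 u (p $ i) = vector [X i, Y i, 0]" for i
    by (simp add: perp_def h) (simp add: p_def u_def vec_eq_iff forall_3 axis_def)
  have tw: "twist 0 u (p $ i) (p $ j) = det2 X Y i j" for i j
    unfolding twist_def pe inner_commute[of u] ui by (simp add: cross_components det2_def)
  have cl: "climb 0 u (p $ i) (p $ j) = Z i - Z j" for i j
    unfolding climb_def h ui by (simp add: u_def)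
  have off: "\<forall>i\<in>Vp. p $ i \<notin> line 0 u"
  proof
    fix i assume "i \<in> Vp"
    then have "X i \<noteq> 0" using gp by (simp add: general_position_def)
    then have "perp 0 u (p $ i) \<noteq> 0" unfolding pe by (simp add: vec_eq_iff forall_3)
    then show "p $ i \<notin> line 0 u" using perp_eq_0_iff[OF u] by blast
  qed
  let ?a = "\<lambda>e. twist 0 u (p $ tail e) (p $ head e)" and ?b = "\<lambda>e. climb 0 u (p $ tail e) (p $ head e)"
  have rigid: "dir_rigid Vp ?P tail head ?a ?b"
    unfolding dir_rigid_def
  proof (intro allI impI)
    fix \<alpha> \<beta> :: "'v \<Rightarrow> real"
    assume k: "\<forall>e\<in>?P. ?a e * (\<alpha> (tail e) - \<alpha> (head e)) + ?b e * (\<beta> (tail e) - \<beta> (head e)) = 0"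
    have "s e * (\<alpha> (tail e) - \<alpha> (head e)) + 1 * (\<beta> (tail e) - \<beta> (head e)) = 0" if e: "e \<in> ?P" for e
    proof -
      have "Z (tail e) - Z (head e) \<noteq> 0"
        using Z td(3-5)[OF e] by (auto dest: inj_onD)
      moreover have "(Z (tail e) - Z (head e)) *
          (s e * (\<alpha> (tail e) - \<alpha> (head e)) + 1 * (\<beta> (tail e) - \<beta> (head e))) = 0"
        using bspec[OF k e] unfolding tw cl geo[OF e, symmetric] by (simp add: algebra_simps)
      ultimately show ?thesis by simp
    qed
    then show "\<forall>i\<in>Vp. \<forall>j\<in>Vp. \<alpha> i = \<alpha> j \<and> \<beta> i = \<beta> j"
      using rs unfolding dir_rigid_def by blast
  qed
  have rem: "\<not> dir_rigid Vp (?P - {e}) tail head ?a ?b" if "e \<in> ?P" for e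
    by (rule tight_rigid_remove_edge[OF t that])
  have ind: "dir_independent ?P tail head ?a ?b"
    by (rule dir_independent_if_minimally_rigid[OF rigid rem])
  have "\<not> infinitesimally_rigid Vp c (E - {e}) p (line 0 u)" if e: "e \<in> E" for e
  proof (cases "c \<in> e")
    case True
    obtain i where i: "e = {i, c}" "i \<noteq> c"
    proof -
      obtain x y where xy: "e = {x, y}" "x \<noteq> y" using c2[OF e] by (meson card_2_iff)
      with True show thesis using that[of x] that[of y] by auto
    qed
    have iV: "i \<in> Vp" using E e i by (auto simp: cone_edges_def)
    show ?thesis unfolding i(1)
      by (rule not_rigid_without_line_edge[OF u E iV _ ind]) (use off iV in blast)
  next
    case False
    have E': "cone_edges Vp c (E - {e})" using E False by (auto simp: cone_edges_def)
    have P': "point_edges c (E - {e}) = ?P - {e}" by (auto simp: point_edges_def)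
    have "e \<in> ?P" using e False by (simp add: point_edges_def)
    then show ?thesis
      using infinitesimally_rigid_iff_dir_rigid[OF u E' V off] rem unfolding P' by blast
  qed
  moreover have "infinitesimally_rigid Vp c E p (line 0 u)"
    by (rule iffD2[OF infinitesimally_rigid_iff_dir_rigid[OF u E V off] rigid])
  moreover have "line 0 u \<in> lines" using u unfolding lines_def by blast
  ultimately show ?thesis unfolding minimally_infinitesimally_rigid_def by blast
qed

theorem corollary5p7:
  fixes V :: "'v::finite set" and E :: "'v set set" and c :: 'v
  assumes "cone_graph V E c"
    and "connected_graph (V - {c}) (induced_edges E (V - {c}))"
    and "card (V - {c}) \<ge> 4"
  shows "maximally_independent (V - {c}) {c} E \<longleftrightarrow>
    (\<exists>(p :: (real^3)^'v) l. l \<in> lines \<and>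
       minimally_infinitesimally_rigid (V - {c}) c E p l)"
proof -
  have E: "cone_edges (V - {c}) c E" by (rule cone_graph_cone_edges[OF assms(1)])
  have V: "V - {c} \<noteq> {}" using assms(3) by (metis card.empty not_numeral_le_zero)
  show ?thesis
    unfolding tight_iff_maximally_independent[OF E]
    using tight_if_minimally_infinitesimally_rigid[OF E V]
      minimally_infinitesimally_rigid_if_tight[OF E V] by blast
qed

end
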